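(* Let $\tau>0$ and let $A\in\mathbb{R}^{m\times n}$. Suppose that the learning rates $\eta_t=\eta=\eta_{\mathsf{PU}}$ of the PU method and $\eta_t=\eta=\eta_{\mathsf{OMWU}}$ of the OMWU method (both defined in the context) satisfy $$0<\eta_{\mathsf{PU}}\le \frac{1}{\tau+2\|A\|_\infty},\qquad 0<\eta_{\mathsf{OMWU}}\le\min\left\{\frac{1}{2\tau+2\|A\|_\infty},\ \frac{1}{4\|A\|_\infty}\right\}.$$ Then for any $t\ge 0$, the iterates $\zeta^{(t)}=(\mu^{(t)},\nu^{(t)})$ and $\bar\zeta^{(t)}=(\bar\mu^{(t)},\bar\nu^{(t)})$ of both PU and OMWU achieve the following. (1) Linear convergence of policies in KL divergence and entrywise log-ratios: $$\max\left\{\mathsf{KL}(\zeta_\tau^\star\,\|\,\zeta^{(t)}),\ \tfrac12\mathsf{KL}(\zeta_\tau^\star\,\|\,\bar\zeta^{(t+1)})\right\}\le(1-\eta\tau)^t\,\mathsf{KL}(\zeta_\tau^\star\,\|\,\zeta^{(0)}),$$ $$\left\|\log\frac{\zeta^{(t)}}{\zeta_\tau^\star}\right\|_\infty\le 2(1-\eta\tau)^t\left\|\log\frac{\zeta^{(0)}}{\zeta_\tau^\star}\right\|_\infty+\frac{8\|A\|_\infty}{\tau}(1-\eta\tau)^{t/2}\,\mathsf{KL}(\zeta_\tau^\star\,\|\,\zeta^{(0)})^{1/2}.$$ (2) Linear convergence of values in optimality and duality gaps: $$\mathsf{OptGap}_\tau(\bar\zeta^{(t)})\le 3\eta^{-1}(1-\eta\tau)^t\,\mathsf{KL}(\zeta_\tau^\star\,\|\,\zeta^{(0)}),$$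 $$\mathsf{DualGap}_\tau(\bar\zeta^{(t)})\le\left(\eta^{-1}+2\tau^{-1}\|A\|_\infty^2\right)(1-\eta\tau)^{t-1}\,\mathsf{KL}(\zeta_\tau^\star\,\|\,\zeta^{(0)}).$$
   Context: Let $\mathcal{A}=\{1,\dots,m\}$, $\mathcal{B}=\{1,\dots,n\}$, and let $\Delta(\mathcal{A}),\Delta(\mathcal{B})$ be the probability simplices over them. $\|A\|_\infty=\max_{i,j}|A_{i,j}|$ for a matrix, and $\|\cdot\|_\infty$ is the usual maximum norm for vectors. Functions such as $\log,\exp$ and ratios of vectors are entrywise. $\mathcal{H}(\pi)=-\sum_i\pi_i\log\pi_i$ is Shannon entropy. For $\tau>0$, $$f_\tau(\mu,\nu)=\mu^\top A\nu+\tau\mathcal{H}(\mu)-\tau\mathcal{H}(\nu),\qquad(\mu,\nu)\in\Delta(\mathcal{A})\times\Delta(\mathcal{B}).$$ The quantal response equilibrium (QRE) $\zeta_\tau^\star=(\mu_\tau^\star,\nu_\tau^\star)$ is the unique solution of $\max_{\mu\in\Delta(\mathcal{A})}\min_{\nu\in\Delta(\mathcal{B})}f_\tau(\mu,\nu)$; it satisfies $\mu_\tau^\star(a)\propto\exp([A\nu_\tau^\star]_a/\tau)$, $\nu_\tau^\star(b)\propto\exp(-[A^\top\mu_\tau^\star]_b/\tau)$. $\mathsf{KL}(\mu\|\mu')=\sum_a\mu(a)\log\frac{\mu(a)}{\mu'(a)}$, and for pairs $\zeta=(\mu,\nu)$, $\zeta'=(\mu',\nu')$, $\mathsf{KL}(\zeta\|\zeta')=\mathsf{KL}(\mu\|\mu')+\mathsf{KL}(\nu\|\nu')$.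 A pair $\zeta=(\mu,\nu)$ is also viewed as the concatenated vector in $\mathbb{R}^{m+n}$. For $\zeta=(\mu,\nu)$: $$\mathsf{DualGap}_\tau(\zeta)=\max_{\mu'\in\Delta(\mathcal{A})}f_\tau(\mu',\nu)-\min_{\nu'\in\Delta(\mathcal{B})}f_\tau(\mu,\nu'),\qquad\mathsf{OptGap}_\tau(\zeta)=|f_\tau(\mu,\nu)-f_\tau(\mu_\tau^\star,\nu_\tau^\star)|.$$ PU method: given an initialization $\zeta^{(0)}=(\mu^{(0)},\nu^{(0)})$, for $t=0,1,2,\dots$ (each line normalized to a probability vector) $$\bar\mu^{(t+1)}(a)\propto\mu^{(t)}(a)^{1-\eta_t\tau}\exp(\eta_t[A\nu^{(t)}]_a),\qquad\bar\nu^{(t+1)}(b)\propto\nu^{(t)}(b)^{1-\eta_t\tau}\exp(-\eta_t[A^\top\mu^{(t)}]_b),$$ $$\mu^{(t+1)}(a)\propto\mu^{(t)}(a)^{1-\eta_t\tau}\exp(\eta_t[A\bar\nu^{(t+1)}]_a),\qquad\nu^{(t+1)}(b)\propto\nu^{(t)}(b)^{1-\eta_t\tau}\exp(-\eta_t[A^\top\bar\mu^{(t+1)}]_b).$$ OMWU method: initialized with $\bar\mu^{(0)}=\mu^{(0)}$, $\bar\nu^{(0)}=\nu^{(0)}$; for $t=0,1,2,\dots$ $$\bar\mu^{(t+1)}(a)\propto\mu^{(t)}(a)^{1-\eta_t\tau}\exp(\eta_t[A\bar\nu^{(t)}]_a),\qquad\bar\nu^{(t+1)}(b)\propto\nu^{(t)}(b)^{1-\eta_t\tau}\exp(-\eta_t[A^\top\bar\mu^{(t)}]_b),$$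 and $\mu^{(t+1)},\nu^{(t+1)}$ are given by the same two formulas as in PU.
   Formalization: Part (2) is stated for t ≥ 1 only: at t = 0 the midpoint is undefined for PU, and for OMWU (where it is the arbitrary initialization) the bounds can fail; the initialization is taken strictly positive so that the KL and log-ratio terms are finite. *)

theory Defs
  imports "HOL-Analysis.Analysis"
begin

text \<open>The action sets are finite types \<open>'m\<close> and \<open>'n\<close>; a pair of policies is an element of
  the Euclidean space \<open>(real ^ 'm) \<times> (real ^ 'n)\<close>, which plays the role of the
  concatenated vector in dimension \<open>CARD('m) + CARD('n)\<close>.\<close>

type_synonym ('m, 'n) policies = "(real ^ 'm) \<times> (real ^ 'n)"

definition prob_simplex :: "(real ^ 'k) set" where
  "prob_simplex = {p. (\<forall>i. 0 \<le> p $ i) \<and> (\<Sum>i\<in>UNIV. p $ i) = 1}"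

definition entry_norm :: "real ^ 'n ^ 'm \<Rightarrow> real" where
  "entry_norm A = Max {\<bar>A $ i $ j\<bar> | i j. True}"

text \<open>Since \<open>0 * ln 0 = 0\<close> in HOL, the usual convention for vanishing probabilities is built in.\<close>

definition shannon_entropy :: "real ^ 'k \<Rightarrow> real" where
  "shannon_entropy p = - (\<Sum>i\<in>UNIV. p $ i * ln (p $ i))"

definition payoff :: "real ^ 'n ^ 'm \<Rightarrow> real \<Rightarrow> real ^ 'm \<Rightarrow> real ^ 'n \<Rightarrow> real" where
  "payoff A \<tau> \<mu> \<nu> = \<mu> \<bullet> (A *v \<nu>) + \<tau> * shannon_entropy \<mu> - \<tau> * shannon_entropy \<nu>"

text \<open>The payoff is continuous on the compact simplices, so every supremum and infimum over a
  simplex below is attained, i.e. is a maximum or a minimum.\<close>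

definition is_qre :: "real ^ 'n ^ 'm \<Rightarrow> real \<Rightarrow> ('m::finite, 'n::finite) policies \<Rightarrow> bool" where
  "is_qre A \<tau> \<zeta> \<longleftrightarrow>
     fst \<zeta> \<in> prob_simplex \<and> snd \<zeta> \<in> prob_simplex \<and>
     (\<forall>\<mu>\<in>prob_simplex.
        (INF \<nu>\<in>prob_simplex. payoff A \<tau> \<mu> \<nu>) \<le> (INF \<nu>\<in>prob_simplex. payoff A \<tau> (fst \<zeta>) \<nu>)) \<and>
     (\<forall>\<nu>\<in>prob_simplex. payoff A \<tau> (fst \<zeta>) (snd \<zeta>) \<le> payoff A \<tau> (fst \<zeta>) \<nu>)"

text \<open>The following two definitions are meant for a strictly positive second argument (HOL sets
  \<open>x / 0 = 0\<close> and \<open>ln 0 = 0\<close>, so the value \<open>\<infinity>\<close> is not represented).\<close>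

definition KL_vec :: "real ^ 'k \<Rightarrow> real ^ 'k \<Rightarrow> real" where
  "KL_vec p q = (\<Sum>i\<in>UNIV. p $ i * ln (p $ i / q $ i))"

definition log_ratio :: "('m::finite, 'n::finite) policies \<Rightarrow> ('m::finite, 'n::finite) policies \<Rightarrow> ('m::finite, 'n::finite) policies" where
  "log_ratio \<zeta> \<zeta>' =
     ((\<chi> a. ln (fst \<zeta> $ a / fst \<zeta>' $ a)), (\<chi> b. ln (snd \<zeta> $ b / snd \<zeta>' $ b)))"

definition KL :: "('m::finite, 'n::finite) policies \<Rightarrow> ('m::finite, 'n::finite) policies \<Rightarrow> real" where
  "KL \<zeta> \<zeta>' = KL_vec (fst \<zeta>) (fst \<zeta>') + KL_vec (snd \<zeta>) (snd \<zeta>')"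

definition dual_gap :: "real ^ 'n ^ 'm \<Rightarrow> real \<Rightarrow> ('m::finite, 'n::finite) policies \<Rightarrow> real" where
  "dual_gap A \<tau> \<zeta> =
     (SUP \<mu>'\<in>prob_simplex. payoff A \<tau> \<mu>' (snd \<zeta>)) - (INF \<nu>'\<in>prob_simplex. payoff A \<tau> (fst \<zeta>) \<nu>')"

definition opt_gap ::
  "real ^ 'n ^ 'm \<Rightarrow> real \<Rightarrow> ('m::finite, 'n::finite) policies \<Rightarrow> ('m::finite, 'n::finite) policies \<Rightarrow> real" where
  "opt_gap A \<tau> \<zeta>s \<zeta> = \<bar>payoff A \<tau> (fst \<zeta>) (snd \<zeta>) - payoff A \<tau> (fst \<zeta>s) (snd \<zeta>s)\<bar>"

definition normalize_vec :: "real ^ 'k \<Rightarrow> real ^ 'k" where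
  "normalize_vec w = (\<chi> i. w $ i / (\<Sum>j\<in>UNIV. w $ j))"

definition mwu_step :: "real \<Rightarrow> real \<Rightarrow> real ^ 'k \<Rightarrow> real ^ 'k \<Rightarrow> real ^ 'k" where
  "mwu_step \<tau> h p g = normalize_vec (\<chi> i. (p $ i) powr (1 - h * \<tau>) * exp (h * g $ i))"

text \<open>One multiplicative update of both players from \<open>\<zeta>\<close>, each responding to the opponent's
  policy in \<open>\<xi>\<close>. All update lines of PU and OMWU are instances of it.\<close>

definition both_step ::
  "real ^ 'n ^ 'm \<Rightarrow> real \<Rightarrow> real \<Rightarrow> ('m::finite, 'n::finite) policies \<Rightarrow> ('m::finite, 'n::finite) policies \<Rightarrow> ('m::finite, 'n::finite) policies" where
  "both_step A \<tau> h \<zeta> \<xi> =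
     (mwu_step \<tau> h (fst \<zeta>) (A *v snd \<xi>), mwu_step \<tau> h (snd \<zeta>) (- (transpose A *v fst \<xi>)))"

text \<open>PU does not define a midpoint at time \<open>0\<close>, so \<open>\<zeta>b 0\<close> is left unconstrained here.\<close>

definition is_PU ::
  "real ^ 'n ^ 'm \<Rightarrow> real \<Rightarrow> (nat \<Rightarrow> real) \<Rightarrow>
   (nat \<Rightarrow> ('m::finite, 'n::finite) policies) \<Rightarrow> (nat \<Rightarrow> ('m::finite, 'n::finite) policies) \<Rightarrow> bool" where
  "is_PU A \<tau> \<eta> \<zeta> \<zeta>b \<longleftrightarrow>
     (\<forall>t. \<zeta>b (Suc t) = both_step A \<tau> (\<eta> t) (\<zeta> t) (\<zeta> t) \<and>
          \<zeta> (Suc t) = both_step A \<tau> (\<eta> t) (\<zeta> t) (\<zeta>b (Suc t)))"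

definition is_OMWU ::
  "real ^ 'n ^ 'm \<Rightarrow> real \<Rightarrow> (nat \<Rightarrow> real) \<Rightarrow>
   (nat \<Rightarrow> ('m::finite, 'n::finite) policies) \<Rightarrow> (nat \<Rightarrow> ('m::finite, 'n::finite) policies) \<Rightarrow> bool" where
  "is_OMWU A \<tau> \<eta> \<zeta> \<zeta>b \<longleftrightarrow>
     \<zeta>b 0 = \<zeta> 0 \<and>
     (\<forall>t. \<zeta>b (Suc t) = both_step A \<tau> (\<eta> t) (\<zeta> t) (\<zeta>b t) \<and>
          \<zeta> (Suc t) = both_step A \<tau> (\<eta> t) (\<zeta> t) (\<zeta>b (Suc t)))"

end

theory Submission
  imports Defs
begin

text \<open>Write the vector field of the game as \<open>gradient A\<close>; it is skew, so it vanishes against its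
  own argument. In logarithmic coordinates one update is affine with fixed point \<open>\<zeta>s\<close>, up to additive
  constants which are orthogonal to differences of policies. Pairing it with the midpoint minus \<open>\<zeta>s\<close> gives an
  exact identity for \<open>KL \<zeta>s (\<zeta> (Suc t))\<close> whose only remainder measures how far the midpoint's
  gradient is from the one it was computed with; Pinsker's inequality absorbs it into the
  negative divergence terms. This makes \<open>KL \<zeta>s (\<zeta> t)\<close> (for PU), respectively
  \<open>KL \<zeta>s (\<zeta> t) + (1 - 2 \<eta> N) KL (\<zeta> t) (\<zeta>b t)\<close> (for OMWU, with \<open>N\<close> the entry norm), contract by
  \<open>1 - \<eta> \<tau>\<close>. The log-ratios are controlled by their span, which is insensitive to the
  normalising constants, and the gaps by expanding the payoff around \<open>\<zeta>s\<close>.\<close>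

section \<open>Strictly positive policies, logarithmic coordinates and the l1 norm\<close>

definition pos_simplex :: "(real ^ 'k) set" where
  "pos_simplex = {p \<in> prob_simplex. \<forall>i. 0 < p $ i}"

definition log_vec :: "real ^ 'k \<Rightarrow> real ^ 'k" where
  "log_vec p = (\<chi> i. ln (p $ i))"

definition l1_norm :: "real ^ 'k \<Rightarrow> real" where
  "l1_norm x = (\<Sum>i\<in>UNIV. \<bar>x $ i\<bar>)"

lemma log_vec_nth [simp]: "log_vec p $ i = ln (p $ i)"
  by (simp add: log_vec_def)

lemma pos_simplex_imp_simplex: "p \<in> pos_simplex \<Longrightarrow> p \<in> prob_simplex"
  by (simp add: pos_simplex_def)

lemma pos_simplex_pos: "p \<in> pos_simplex \<Longrightarrow> 0 < p $ i"
  by (simp add: pos_simplex_def)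

lemma prob_simplex_nonneg: "p \<in> prob_simplex \<Longrightarrow> 0 \<le> p $ i"
  by (simp add: prob_simplex_def)

lemma prob_simplex_sum: "p \<in> prob_simplex \<Longrightarrow> (\<Sum>i\<in>UNIV. p $ i) = 1"
  by (simp add: prob_simplex_def)

text \<open>Normalising an update adds a constant vector to the logarithms. Since it pairs equally
  with all policies, it cancels against their differences.\<close>

lemma inner_vec_const: "p \<in> prob_simplex \<Longrightarrow> p \<bullet> vec c = c"
  by (simp add: inner_vec_def prob_simplex_sum flip: sum_distrib_right)

lemma KL_vec_inner:
  assumes "p \<in> prob_simplex" "q \<in> pos_simplex"
  shows "KL_vec p q = p \<bullet> (log_vec p - log_vec q)"
proof -
  \<comment> \<open>Coordinates with p $ i = 0 contribute 0 to both sides. Allowing them matters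
    because the gap bounds compare with competitors on the boundary of the simplex.\<close>
  have "p $ i * ln (p $ i / q $ i) = p $ i * (ln (p $ i) - ln (q $ i))" for i
    using prob_simplex_nonneg[OF assms(1), of i] pos_simplex_pos[OF assms(2), of i]
    by (cases "p $ i = 0") (auto simp: ln_div)
  then show ?thesis
    unfolding KL_vec_def inner_vec_def by (simp only: vector_minus_component log_vec_nth inner_real_def)
qed

lemma shannon_entropy_inner: "shannon_entropy p = - (p \<bullet> log_vec p)"
  by (simp add: shannon_entropy_def inner_vec_def)

subsection \<open>Pinsker's inequality\<close>

text \<open>The rational minorant is the one for which the pointwise inequality
  \<open>3 (u - 1)^2 \<le> (4 + 2 u) (u ln u - u + 1)\<close> behind Pinsker's inequality becomes an identity.\<close>

lemma ln_ge_rational: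
  fixes u :: real
  assumes "u > 0"
  shows "(u - 1) * (5 * u + 1) / (2 * u * (u + 2)) \<le> ln u"
proof -
  \<comment> \<open>\<open>f\<close> vanishes at 1 and its derivative has the sign of x - 1, so 1 is
    its minimum on the positive half-line.\<close>
  define f where "f u = ln u - (u - 1) * (5 * u + 1) / (2 * u * (u + 2))" for u :: real
  have der: "(f has_real_derivative (x - 1) ^ 3 / (x\<^sup>2 * (x + 2)\<^sup>2)) (at x)" if "x > 0" for x
  proof -
    have "1 / x - ((1 * (5 * x + 1) + (x - 1) * 5) * (2 * x * (x + 2))
          - (x - 1) * (5 * x + 1) * (2 * (x + 2) + 2 * x)) / (2 * x * (x + 2))\<^sup>2
        = (x - 1) ^ 3 / (x\<^sup>2 * (x + 2)\<^sup>2)"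
      using that by (simp add: divide_simps) algebra
    then show ?thesis
      unfolding f_def using that
      by (auto intro!: derivative_eq_intros) (simp add: power2_eq_square)
  qed
  have "f 1 \<le> f u"
  proof (cases "u \<ge> 1")
    case True
    show ?thesis
    proof (rule DERIV_nonneg_imp_nondecreasing[OF True])
      fix x :: real assume x: "1 \<le> x" "x \<le> u"
      have "0 \<le> (x - 1) ^ 3 / (x\<^sup>2 * (x + 2)\<^sup>2)"
        using x by simp
      then show "\<exists>y. (f has_real_derivative y) (at x) \<and> 0 \<le> y"
        using der[of x] x by (intro exI conjI) auto
    qed
  next
    case False
    show ?thesis
    proof (rule DERIV_nonpos_imp_nonincreasing[of u 1 f])
      show "u \<le> 1" using False by simp
      fix x assume x: "u \<le> x" "x \<le> 1"
      have "(x - 1) ^ 3 \<le> 0"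
        using x by (simp add: power_le_zero_eq)
      then have "(x - 1) ^ 3 / (x\<^sup>2 * (x + 2)\<^sup>2) \<le> 0"
        by (simp add: divide_nonpos_nonneg)
      then show "\<exists>y. (f has_real_derivative y) (at x) \<and> y \<le> 0"
        using der[of x] x assms by (intro exI conjI) auto
    qed
  qed
  then show ?thesis by (simp add: f_def)
qed

text \<open>Both sides are homogeneous of degree two in (p, q). Dividing by q^2 leaves a claim about
  u = p / q, in which the rational minorant of \<open>ln\<close> produces exactly the left
  side.\<close>

lemma scaled_pinsker_pointwise:
  fixes p q :: real
  assumes "0 \<le> p" "0 < q"
  shows "3 * (p - q)\<^sup>2 \<le> (4 * q + 2 * p) * (p * (ln p - ln q) - p + q)"
proof (cases "p = 0")
  case True
  then show ?thesis by (simp add: power2_eq_square)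
next
  case False
  then have p: "p > 0" using assms by simp
  define u where "u = p / q"
  have u: "u > 0" "p = u * q" using p assms by (auto simp: u_def)
  have L: "ln p - ln q = ln u" using p assms by (simp add: u_def ln_div)
  have "3 * (u - 1)\<^sup>2 = (4 + 2 * u) * (u * ((u - 1) * (5 * u + 1) / (2 * u * (u + 2))) - u + 1)"
    using u(1) by (simp add: divide_simps power2_eq_square) (simp add: algebra_simps)
  also have "\<dots> \<le> (4 + 2 * u) * (u * ln u - u + 1)"
  proof (rule mult_left_mono)
    have "u * ((u - 1) * (5 * u + 1) / (2 * u * (u + 2))) \<le> u * ln u"
      using ln_ge_rational[OF u(1)] less_imp_le[OF u(1)] by (rule mult_left_mono)
    then show "u * ((u - 1) * (5 * u + 1) / (2 * u * (u + 2))) - u + 1 \<le> u * ln u - u + 1"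
      by linarith
  qed (use u(1) in simp)
  finally have "3 * (u - 1)\<^sup>2 \<le> (4 + 2 * u) * (u * ln u - u + 1)" .
  then have "q\<^sup>2 * (3 * (u - 1)\<^sup>2) \<le> q\<^sup>2 * ((4 + 2 * u) * (u * ln u - u + 1))"
    by (intro mult_left_mono) auto
  then show ?thesis
    unfolding L unfolding u(2) by (simp add: power2_eq_square algebra_simps)
qed

text \<open>Cauchy-Schwarz applied to the pointwise bound (p - q)^2 \<le> a b: the weights
  \<open>a\<close> have total mass (4 + 2) / 3 = 2, and the linear terms of \<open>b\<close> cancel
  in the sum, leaving the divergence.\<close>

lemma pinsker:
  assumes "p \<in> prob_simplex" "q \<in> pos_simplex"
  shows "(l1_norm (p - q))\<^sup>2 \<le> 2 * KL_vec p q"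
proof -
  define a where "a i = (4 * q $ i + 2 * p $ i) / 3" for i
  define b where "b i = p $ i * (ln (p $ i) - ln (q $ i)) - p $ i + q $ i" for i
  have a0: "a i > 0" for i
    using prob_simplex_nonneg[OF assms(1), of i] pos_simplex_pos[OF assms(2), of i]
    by (simp add: a_def)
  have ab: "(p $ i - q $ i)\<^sup>2 \<le> a i * b i" for i
    using scaled_pinsker_pointwise[OF prob_simplex_nonneg[OF assms(1), of i] pos_simplex_pos[OF assms(2), of i]]
    by (simp add: a_def b_def field_simps)
  have b0: "b i \<ge> 0" for i
    using ab[of i] a0[of i] by (metis order_trans zero_le_power2 zero_le_mult_iff not_less)
  have sa: "(\<Sum>i\<in>UNIV. a i) = 2"
    using prob_simplex_sum[OF assms(1)] prob_simplex_sum[OF pos_simplex_imp_simplex[OF assms(2)]]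
    by (simp add: a_def sum.distrib flip: sum_divide_distrib sum_distrib_left)
  have sb: "(\<Sum>i\<in>UNIV. b i) = KL_vec p q"
    using prob_simplex_sum[OF assms(1)] prob_simplex_sum[OF pos_simplex_imp_simplex[OF assms(2)]]
    by (simp add: b_def sum.distrib sum_subtractf KL_vec_inner[OF assms] inner_vec_def)
  have "l1_norm (p - q) \<le> (\<Sum>i\<in>UNIV. sqrt (a i) * sqrt (b i))"
    unfolding l1_norm_def
  proof (rule sum_mono)
    fix i
    show "\<bar>(p - q) $ i\<bar> \<le> sqrt (a i) * sqrt (b i)"
      using real_sqrt_le_mono[OF ab[of i]] by (simp add: real_sqrt_mult)
  qed
  then have "(l1_norm (p - q))\<^sup>2 \<le> (\<Sum>i\<in>UNIV. sqrt (a i) * sqrt (b i))\<^sup>2"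
    by (intro power_mono) (auto simp: l1_norm_def intro: sum_nonneg)
  also have "\<dots> \<le> (\<Sum>i\<in>UNIV. (sqrt (a i))\<^sup>2) * (\<Sum>i\<in>UNIV. (sqrt (b i))\<^sup>2)"
    by (rule Cauchy_Schwarz_ineq_sum)
  also have "\<dots> = 2 * KL_vec p q"
    using a0 b0 by (simp add: sa sb less_imp_le)
  finally show ?thesis .
qed

lemma KL_vec_nonneg: "p \<in> prob_simplex \<Longrightarrow> q \<in> pos_simplex \<Longrightarrow> 0 \<le> KL_vec p q"
  using pinsker[of p q] zero_le_power2[of "l1_norm (p - q)"] by linarith

lemma KL_vec_le_0_imp_eq:
  assumes "p \<in> prob_simplex" "q \<in> pos_simplex" "KL_vec p q \<le> 0"
  shows "p = q"
proof -
  have "(l1_norm (p - q))\<^sup>2 \<le> 0"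
    using pinsker[OF assms(1,2)] assms(3) by linarith
  then have "(\<Sum>i\<in>UNIV. \<bar>(p - q) $ i\<bar>) = 0"
    by (simp add: l1_norm_def)
  then show ?thesis
    by (simp add: sum_nonneg_eq_0_iff vec_eq_iff)
qed

subsection \<open>Multiplicative updates\<close>

lemma normalize_vec_pos:
  assumes "\<And>i. 0 < w $ i"
  shows "normalize_vec w \<in> pos_simplex"
    and "\<exists>c. log_vec (normalize_vec w) = log_vec w + vec c"
proof -
  have s: "0 < (\<Sum>j\<in>UNIV. w $ j)"
    using assms by (intro sum_pos) auto
  have "(\<Sum>i\<in>UNIV. w $ i / (\<Sum>j\<in>UNIV. w $ j)) = 1"
    using s by (simp flip: sum_divide_distrib)
  then show "normalize_vec w \<in> pos_simplex"
    using assms s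
    by (simp add: pos_simplex_def prob_simplex_def normalize_vec_def less_imp_le)
  show "\<exists>c. log_vec (normalize_vec w) = log_vec w + vec c"
    using assms s less_imp_neq[OF assms, symmetric]
    by (intro exI[of _ "- ln (\<Sum>j\<in>UNIV. w $ j)"]) (simp add: vec_eq_iff normalize_vec_def ln_div)
qed

text \<open>Taking logarithms turns the update into an affine map. The normalising factor becomes
  the constant \<open>c\<close>, left existential because later uses cancel it.\<close>

lemma mwu_step_pos:
  assumes "p \<in> pos_simplex"
  shows "mwu_step \<tau> h p g \<in> pos_simplex"
    and "\<exists>c. log_vec (mwu_step \<tau> h p g) = (1 - h * \<tau>) *\<^sub>R log_vec p + h *\<^sub>R g + vec c"
proof -
  let ?w = "\<chi> i. (p $ i) powr (1 - h * \<tau>) * exp (h * g $ i)"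
  have p: "0 < p $ i" for i using assms by (rule pos_simplex_pos)
  have w: "0 < ?w $ i" for i using p[of i] by simp
  have "log_vec ?w = (1 - h * \<tau>) *\<^sub>R log_vec p + h *\<^sub>R g"
    using p less_imp_neq[OF p, symmetric] by (simp add: vec_eq_iff ln_mult)
  then show "\<exists>c. log_vec (mwu_step \<tau> h p g) = (1 - h * \<tau>) *\<^sub>R log_vec p + h *\<^sub>R g + vec c"
    using normalize_vec_pos(2)[of ?w, OF w] by (simp only: mwu_step_def)
  show "mwu_step \<tau> h p g \<in> pos_simplex"
    using normalize_vec_pos(1)[of ?w, OF w] by (simp only: mwu_step_def)
qed


subsection \<open>The bilinear game\<close>

text \<open>Each player's ascent direction for the bilinear payoff. The sign in the second component
  turns minimisation into ascent and makes the field skew.\<close>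

definition gradient :: "real ^ 'n ^ 'm \<Rightarrow> ('m::finite, 'n::finite) policies \<Rightarrow> ('m, 'n) policies" where
  "gradient A \<xi> = (A *v snd \<xi>, - (transpose A *v fst \<xi>))"

definition log_pair :: "('m::finite, 'n::finite) policies \<Rightarrow> ('m, 'n) policies" where
  "log_pair \<zeta> = (log_vec (fst \<zeta>), log_vec (snd \<zeta>))"

text \<open>The squares are taken per player, to match Pinsker's inequality in each summand of
  \<open>KL\<close>.\<close>

definition l1_sq :: "('m::finite, 'n::finite) policies \<Rightarrow> real" where
  "l1_sq z = (l1_norm (fst z))\<^sup>2 + (l1_norm (snd z))\<^sup>2"

lemma l1_norm_minus_commute: "l1_norm (x - y) = l1_norm (y - x)"
  by (simp add: l1_norm_def abs_minus_commute)

lemma l1_sq_minus_commute: "l1_sq (x - y) = l1_sq (y - x)"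
  by (simp add: l1_sq_def l1_norm_minus_commute)

lemma entry_norm_ge: "\<bar>A $ i $ j\<bar> \<le> entry_norm (A :: real ^ 'n ^ 'm)"
proof -
  have "{\<bar>A $ i $ j\<bar> | i j. True} = range (\<lambda>(i, j). \<bar>A $ i $ j\<bar>)"
    by auto
  then have "finite {\<bar>A $ i $ j\<bar> | i j. True}"
    by simp
  then show ?thesis
    unfolding entry_norm_def by (rule Max_ge) auto
qed

lemma entry_norm_nonneg: "0 \<le> entry_norm A"
  using entry_norm_ge[of A undefined undefined] by linarith

lemma entry_norm_transpose: "entry_norm (transpose A) = entry_norm A"
  unfolding entry_norm_def transpose_def by (rule arg_cong[where f = Max]) auto

lemma matrix_vector_nth_bound: "\<bar>(A *v y) $ i\<bar> \<le> entry_norm A * l1_norm y"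
proof -
  have "\<bar>(A *v y) $ i\<bar> \<le> (\<Sum>j\<in>UNIV. \<bar>A $ i $ j * y $ j\<bar>)"
    by (simp add: matrix_vector_mult_def)
  also have "\<dots> \<le> (\<Sum>j\<in>UNIV. entry_norm A * \<bar>y $ j\<bar>)"
    by (intro sum_mono) (simp add: abs_mult mult_right_mono entry_norm_ge)
  finally show ?thesis
    by (simp add: l1_norm_def sum_distrib_left)
qed

lemma bilinear_bound: "\<bar>x \<bullet> (A *v y)\<bar> \<le> entry_norm A * (l1_norm x * l1_norm y)"
proof -
  have "\<bar>x \<bullet> (A *v y)\<bar> \<le> (\<Sum>i\<in>UNIV. \<bar>x $ i * (A *v y) $ i\<bar>)"
    by (simp add: inner_vec_def)
  also have "\<dots> \<le> (\<Sum>i\<in>UNIV. \<bar>x $ i\<bar> * (entry_norm A * l1_norm y))"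
    by (intro sum_mono) (simp add: abs_mult mult_left_mono matrix_vector_nth_bound)
  also have "\<dots> = entry_norm A * (l1_norm x * l1_norm y)"
    by (simp add: l1_norm_def flip: sum_distrib_right)
  finally show ?thesis .
qed

lemma bilinear_bound_sq:
  "\<bar>x \<bullet> (A *v y)\<bar> \<le> entry_norm A / 2 * ((l1_norm x)\<^sup>2 + (l1_norm y)\<^sup>2)"
proof -
  have "l1_norm x * l1_norm y \<le> ((l1_norm x)\<^sup>2 + (l1_norm y)\<^sup>2) / 2"
    using sum_squares_bound[of "l1_norm x" "l1_norm y"] by simp
  from mult_left_mono[OF this entry_norm_nonneg[of A]] bilinear_bound[of x A y]
  show ?thesis by simp
qed

lemma transpose_inner: "(transpose A *v x) \<bullet> y = x \<bullet> (A *v y)"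
  for A :: "real ^ 'n ^ 'm"
  by (simp add: dot_lmul_matrix transpose_matrix_vector)

lemma gradient_inner:
  "gradient A \<xi> \<bullet> z = fst z \<bullet> (A *v snd \<xi>) - fst \<xi> \<bullet> (A *v snd z)"
  by (simp add: gradient_def inner_prod_def dot_lmul_matrix inner_commute[of "A *v snd \<xi>"])

lemma gradient_diff: "gradient A (x - y) = gradient A x - gradient A y"
  by (simp add: gradient_def matrix_vector_mult_diff_distrib)

lemma gradient_inner_self: "gradient A z \<bullet> z = 0"
  by (simp add: gradient_inner)

text \<open>Each bilinear term couples one player's part of \<xi> with the other player's part of
  \<open>z\<close>, so the four squares from the two estimates add up to one \<open>l1_sq\<close>
  each. No factor 2 is lost, which keeps the step sizes large.\<close>

lemma gradient_inner_bound: "\<bar>gradient A \<xi> \<bullet> z\<bar> \<le> entry_norm A / 2 * (l1_sq \<xi> + l1_sq z)"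
proof -
  have "\<bar>gradient A \<xi> \<bullet> z\<bar> \<le> \<bar>fst z \<bullet> (A *v snd \<xi>)\<bar> + \<bar>fst \<xi> \<bullet> (A *v snd z)\<bar>"
    by (simp add: gradient_inner)
  also have "\<dots> \<le> entry_norm A / 2 * (l1_sq \<xi> + l1_sq z)"
    using bilinear_bound_sq[of "fst z" A "snd \<xi>"] bilinear_bound_sq[of "fst \<xi>" A "snd z"]
    by (simp add: l1_sq_def algebra_simps)
  finally show ?thesis .
qed

lemma both_step_gradient:
  "both_step A \<tau> h \<zeta> \<xi> =
     (mwu_step \<tau> h (fst \<zeta>) (fst (gradient A \<xi>)), mwu_step \<tau> h (snd \<zeta>) (snd (gradient A \<xi>)))"
  by (simp add: both_step_def gradient_def)

lemma both_step_pos: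
  assumes "\<zeta> \<in> pos_simplex \<times> pos_simplex"
  shows "both_step A \<tau> h \<zeta> \<xi> \<in> pos_simplex \<times> pos_simplex"
  using assms by (auto simp: both_step_gradient mwu_step_pos(1))

lemma log_pair_both_step:
  assumes "\<zeta> \<in> pos_simplex \<times> pos_simplex"
  obtains c d where "log_pair (both_step A \<tau> h \<zeta> \<xi>) =
    (1 - h * \<tau>) *\<^sub>R log_pair \<zeta> + h *\<^sub>R gradient A \<xi> + (vec c, vec d)"
proof -
  have "fst \<zeta> \<in> pos_simplex" "snd \<zeta> \<in> pos_simplex"
    using assms by auto
  from mwu_step_pos(2)[OF this(1), of \<tau> h "fst (gradient A \<xi>)"]
    mwu_step_pos(2)[OF this(2), of \<tau> h "snd (gradient A \<xi>)"]
  show thesis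
    using that by (force simp: both_step_gradient log_pair_def prod_eq_iff)
qed

lemma pair_const_orthogonal:
  assumes "z \<in> prob_simplex \<times> prob_simplex" "w \<in> prob_simplex \<times> prob_simplex"
  shows "(z - w) \<bullet> (vec c, vec d) = 0"
  using assms by (auto simp: inner_prod_def inner_diff_left inner_vec_const)

lemma pos_imp_simplex_pair:
  "z \<in> pos_simplex \<times> pos_simplex \<Longrightarrow> z \<in> prob_simplex \<times> prob_simplex"
  by (auto simp: pos_simplex_imp_simplex)

lemma KL_inner:
  assumes "z \<in> pos_simplex \<times> pos_simplex" "w \<in> pos_simplex \<times> pos_simplex"
  shows "KL z w = z \<bullet> (log_pair z - log_pair w)"
  using assms by (auto simp: KL_def KL_vec_inner pos_simplex_imp_simplex log_pair_def inner_prod_def)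

lemma pinsker_pair:
  assumes "z \<in> pos_simplex \<times> pos_simplex" "w \<in> pos_simplex \<times> pos_simplex"
  shows "l1_sq (z - w) \<le> 2 * KL z w"
  using pinsker[of "fst z" "fst w"] pinsker[of "snd z" "snd w"] assms
  by (auto simp: KL_def l1_sq_def pos_simplex_imp_simplex)

lemma KL_nonneg:
  assumes "z \<in> pos_simplex \<times> pos_simplex" "w \<in> pos_simplex \<times> pos_simplex"
  shows "0 \<le> KL z w"
  using assms by (auto simp: KL_def KL_vec_nonneg pos_simplex_imp_simplex)

lemma KL_self:
  assumes "z \<in> pos_simplex \<times> pos_simplex"
  shows "KL z z = 0"
  using assms by (simp add: KL_inner)

subsection \<open>Characterisation of the equilibrium\<close>

definition softmax :: "real \<Rightarrow> real ^ 'k \<Rightarrow> real ^ 'k" where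
  "softmax \<tau> g = normalize_vec (\<chi> i. exp (g $ i / \<tau>))"

lemma softmax_pos: "softmax \<tau> g \<in> pos_simplex"
  unfolding softmax_def by (rule normalize_vec_pos) simp

lemma log_vec_softmax:
  assumes "\<tau> > 0"
  obtains c where "\<tau> *\<^sub>R log_vec (softmax \<tau> g) = g + vec c"
proof -
  obtain c where c: "log_vec (softmax \<tau> g) = log_vec (\<chi> i. exp (g $ i / \<tau>)) + vec c"
    using normalize_vec_pos(2)[of "\<chi> i. exp (g $ i / \<tau>)"] by (auto simp: softmax_def)
  show thesis
    by (rule that[of "\<tau> * c"]) (use assms in \<open>simp add: c vec_eq_iff distrib_left\<close>)
qed

text \<open>Up to a constant, \<open>g\<close> is \<tau> times the logarithm of its softmax, so the
  objective equals a constant minus \<tau> times a divergence. The exact deficit, not just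
  optimality, is needed for expanding the payoff.\<close>

lemma gibbs_variational:
  assumes "\<tau> > 0" "p \<in> prob_simplex"
  shows "p \<bullet> g + \<tau> * shannon_entropy p =
    softmax \<tau> g \<bullet> g + \<tau> * shannon_entropy (softmax \<tau> g) - \<tau> * KL_vec p (softmax \<tau> g)"
proof -
  obtain c where c: "\<tau> *\<^sub>R log_vec (softmax \<tau> g) = g + vec c"
    using log_vec_softmax[OF assms(1)] .
  have *: "r \<bullet> g + \<tau> * shannon_entropy r = - c - \<tau> * KL_vec r (softmax \<tau> g)"
    if r: "r \<in> prob_simplex" for r
  proof -
    have "g = \<tau> *\<^sub>R log_vec (softmax \<tau> g) - vec c"
      using c by simp
    then have "r \<bullet> g = \<tau> * (r \<bullet> log_vec (softmax \<tau> g)) - c"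
      using inner_vec_const[OF r] by (metis inner_diff_right inner_scaleR_right)
    then show ?thesis
      using r by (simp add: KL_vec_inner softmax_pos shannon_entropy_inner inner_diff_right algebra_simps)
  qed
  have "KL_vec (softmax \<tau> g) (softmax \<tau> g) = 0"
    by (simp add: KL_vec_inner softmax_pos pos_simplex_imp_simplex)
  then show ?thesis
    using *[OF assms(2)] *[of "softmax \<tau> g"] by (simp add: softmax_pos pos_simplex_imp_simplex)
qed

lemma softmax_maximizes:
  assumes "\<tau> > 0" "p \<in> prob_simplex"
  shows "p \<bullet> g + \<tau> * shannon_entropy p \<le> softmax \<tau> g \<bullet> g + \<tau> * shannon_entropy (softmax \<tau> g)"
  using gibbs_variational[OF assms, of g] KL_vec_nonneg[OF assms(2) softmax_pos[of \<tau> g]] assms(1)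
    mult_nonneg_nonneg[of \<tau> "KL_vec p (softmax \<tau> g)"] by linarith

lemma softmax_unique:
  assumes "\<tau> > 0" "p \<in> prob_simplex"
    and "softmax \<tau> g \<bullet> g + \<tau> * shannon_entropy (softmax \<tau> g) \<le> p \<bullet> g + \<tau> * shannon_entropy p"
  shows "p = softmax \<tau> g"
proof (rule KL_vec_le_0_imp_eq[OF assms(2) softmax_pos])
  have "\<tau> * KL_vec p (softmax \<tau> g) \<le> 0"
    using gibbs_variational[OF assms(1,2), of g] assms(3) by linarith
  then show "KL_vec p (softmax \<tau> g) \<le> 0"
    using assms(1) by (simp add: mult_le_0_iff)
qed

lemma tendsto_softmax:
  assumes "(g \<longlongrightarrow> l) F"
  shows "((\<lambda>x. softmax \<tau> (g x)) \<longlongrightarrow> softmax \<tau> l) F"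
proof -
  have "(\<Sum>j\<in>UNIV. exp (l $ j / \<tau>)) > 0"
    by (intro sum_pos) auto
  then show ?thesis
    unfolding softmax_def normalize_vec_def divide_inverse[of "_ $ _" \<tau>]
    by (intro vec_tendstoI) (auto intro!: tendsto_intros assms simp: divide_inverse)
qed

text \<open>Concavity by Gibbs' inequality: entropy is at most cross-entropy against the mixture,
  and cross-entropy is linear in its first argument. Only \<open>r\<close> is positive here, since
  positivity of the equilibrium is not yet known.\<close>

lemma entropy_mixture:
  assumes "p \<in> prob_simplex" "r \<in> pos_simplex" "0 < s" "s \<le> 1"
  shows "(1 - s) *\<^sub>R p + s *\<^sub>R r \<in> pos_simplex"
    and "(1 - s) * shannon_entropy p + s * shannon_entropy r
      \<le> shannon_entropy ((1 - s) *\<^sub>R p + s *\<^sub>R r)"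
proof -
  let ?m = "(1 - s) *\<^sub>R p + s *\<^sub>R r"
  have "0 < (1 - s) * p $ i + s * r $ i" for i
    using prob_simplex_nonneg[OF assms(1), of i] pos_simplex_pos[OF assms(2), of i] assms(3,4)
    by (simp add: add_nonneg_pos)
  then show m: "?m \<in> pos_simplex"
    using prob_simplex_sum[OF assms(1)] prob_simplex_sum[OF pos_simplex_imp_simplex[OF assms(2)]]
    by (simp add: pos_simplex_def prob_simplex_def less_imp_le sum.distrib flip: sum_distrib_left)
  have *: "shannon_entropy v \<le> - (v \<bullet> log_vec ?m)" if "v \<in> prob_simplex" for v
    using KL_vec_nonneg[OF that m] KL_vec_inner[OF that m]
    by (simp add: shannon_entropy_inner inner_diff_right)
  have "(1 - s) * shannon_entropy p + s * shannon_entropy r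
      \<le> (1 - s) * - (p \<bullet> log_vec ?m) + s * - (r \<bullet> log_vec ?m)"
    using *[OF assms(1)] *[OF pos_simplex_imp_simplex[OF assms(2)]] assms(3,4)
    by (intro add_mono mult_left_mono) auto
  also have "\<dots> = shannon_entropy ?m"
    by (simp add: shannon_entropy_inner inner_add_left)
  finally show "(1 - s) * shannon_entropy p + s * shannon_entropy r \<le> shannon_entropy ?m" .
qed

text \<open>Shows the minimiser's problem to be a softmax maximisation with reversed sign, so the
  same variational facts serve both players.\<close>

lemma payoff_as_response:
  "payoff A \<tau> \<mu> \<nu> =
    \<tau> * shannon_entropy \<mu> - (\<nu> \<bullet> (- (transpose A *v \<mu>)) + \<tau> * shannon_entropy \<nu>)"
  using transpose_inner[of A \<mu> \<nu>] by (simp add: payoff_def inner_commute)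

lemma softmax_minimizes_payoff:
  assumes "\<tau> > 0" "\<nu> \<in> prob_simplex"
  shows "payoff A \<tau> \<mu> (softmax \<tau> (- (transpose A *v \<mu>))) \<le> payoff A \<tau> \<mu> \<nu>"
  unfolding payoff_as_response
  using softmax_maximizes[OF assms, of "- (transpose A *v \<mu>)"] by linarith

lemma payoff_bdd_below:
  assumes "\<tau> > 0"
  shows "bdd_below (payoff A \<tau> \<mu> ` prob_simplex)"
  using softmax_minimizes_payoff[OF assms] by (rule bdd_belowI2)

lemma qre_snd:
  assumes "\<tau> > 0" "is_qre A \<tau> \<zeta>s"
  shows "snd \<zeta>s = softmax \<tau> (- (transpose A *v fst \<zeta>s))"
proof (rule softmax_unique[OF assms(1)])
  let ?r = "softmax \<tau> (- (transpose A *v fst \<zeta>s))"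
  show "snd \<zeta>s \<in> prob_simplex"
    using assms(2) by (simp add: is_qre_def)
  have "payoff A \<tau> (fst \<zeta>s) (snd \<zeta>s) \<le> payoff A \<tau> (fst \<zeta>s) ?r"
    using assms(2) pos_simplex_imp_simplex[OF softmax_pos] unfolding is_qre_def by blast
  then show "?r \<bullet> (- (transpose A *v fst \<zeta>s)) + \<tau> * shannon_entropy ?r
      \<le> snd \<zeta>s \<bullet> (- (transpose A *v fst \<zeta>s)) + \<tau> * shannon_entropy (snd \<zeta>s)"
    unfolding payoff_as_response by linarith
qed

text \<open>The minimal payoff is a concave function of the first player's policy. Moving its
  maximiser slightly towards the best response \<open>r\<close> against \<open>snd \<zeta>s\<close> does not increase it;
  in the limit, as in Danskin's theorem, the maximiser does as well as \<open>r\<close>.\<close>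

lemma qre_fst:
  assumes "\<tau> > 0" "is_qre A \<tau> \<zeta>s"
  shows "fst \<zeta>s = softmax \<tau> (A *v snd \<zeta>s)"
proof (rule softmax_unique[OF assms(1)])
  let ?\<mu> = "fst \<zeta>s"
  define r where "r = softmax \<tau> (A *v snd \<zeta>s)"
  define m where "m s = (1 - s) *\<^sub>R ?\<mu> + s *\<^sub>R r" for s :: real
  define n where "n s = softmax \<tau> (- (transpose A *v m s))" for s
  show mu: "?\<mu> \<in> prob_simplex"
    using assms(2) by (simp add: is_qre_def)
  have r: "r \<in> pos_simplex" by (simp add: r_def softmax_pos)
  have n: "n s \<in> prob_simplex" for s
    by (simp add: n_def softmax_pos pos_simplex_imp_simplex)
  have le: "r \<bullet> (A *v n s) + \<tau> * shannon_entropy r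
      \<le> ?\<mu> \<bullet> (A *v n s) + \<tau> * shannon_entropy ?\<mu>" if s: "0 < s" "s \<le> 1" for s
  proof -
    have ms: "m s \<in> prob_simplex"
      using entropy_mixture(1)[OF mu r s] by (simp add: m_def pos_simplex_imp_simplex)
    have "payoff A \<tau> (m s) (n s) \<le> (INF \<nu>\<in>prob_simplex. payoff A \<tau> (m s) \<nu>)"
      using n unfolding n_def by (intro cINF_greatest softmax_minimizes_payoff[OF assms(1)]) auto
    \<comment> \<open>By the maximin property, the guaranteed value of \<open>m s\<close> cannot
      exceed that of the equilibrium policy; \<open>n s\<close> realises the former and bounds the
      latter.\<close>
    also have "\<dots> \<le> (INF \<nu>\<in>prob_simplex. payoff A \<tau> ?\<mu> \<nu>)"
      using assms(2) ms by (simp add: is_qre_def)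
    also have "\<dots> \<le> payoff A \<tau> ?\<mu> (n s)"
      by (rule cINF_lower[OF payoff_bdd_below[OF assms(1)] n])
    finally have "m s \<bullet> (A *v n s) + \<tau> * shannon_entropy (m s)
        \<le> ?\<mu> \<bullet> (A *v n s) + \<tau> * shannon_entropy ?\<mu>"
      by (simp add: payoff_def)
    moreover have "\<tau> * ((1 - s) * shannon_entropy ?\<mu> + s * shannon_entropy r)
        \<le> \<tau> * shannon_entropy (m s)"
      using entropy_mixture(2)[OF mu r s] assms(1) by (simp add: m_def)
    \<comment> \<open>Concavity of entropy lets the share 1 - s belonging to the equilibrium policy
      cancel on both sides, leaving a common factor \<open>s\<close> to divide out.\<close>
    ultimately have "s * (r \<bullet> (A *v n s) + \<tau> * shannon_entropy r)
        \<le> s * (?\<mu> \<bullet> (A *v n s) + \<tau> * shannon_entropy ?\<mu>)"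
      by (simp add: m_def inner_add_left algebra_simps)
    then show ?thesis using s by simp
  qed
  have m0: "(m \<longlongrightarrow> ?\<mu>) (at_right 0)"
    unfolding m_def by (auto intro!: tendsto_eq_intros)
  have "(n \<longlongrightarrow> softmax \<tau> (- (transpose A *v ?\<mu>))) (at_right 0)"
    unfolding n_def
    by (intro tendsto_softmax tendsto_minus
        bounded_linear.tendsto[OF matrix_vector_mul_bounded_linear] m0)
  \<comment> \<open>At s = 0 the response is the one against the equilibrium policy itself, which is
    already identified with the second component.\<close>
  then have n0: "(n \<longlongrightarrow> snd \<zeta>s) (at_right 0)"
    using qre_snd[OF assms] by simp
  have lim: "((\<lambda>s. v \<bullet> (A *v n s) + \<tau> * shannon_entropy v)
      \<longlongrightarrow> v \<bullet> (A *v snd \<zeta>s) + \<tau> * shannon_entropy v) (at_right 0)" for v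
    by (intro tendsto_intros bounded_linear.tendsto[OF matrix_vector_mul_bounded_linear] n0)
  have "\<forall>\<^sub>F s in at_right 0. r \<bullet> (A *v n s) + \<tau> * shannon_entropy r
      \<le> ?\<mu> \<bullet> (A *v n s) + \<tau> * shannon_entropy ?\<mu>"
    unfolding eventually_at_right_field by (intro exI[of _ 1]) (auto intro: le)
  from tendsto_le[OF _ lim lim this]
  show "softmax \<tau> (A *v snd \<zeta>s) \<bullet> (A *v snd \<zeta>s) + \<tau> * shannon_entropy (softmax \<tau> (A *v snd \<zeta>s))
      \<le> ?\<mu> \<bullet> (A *v snd \<zeta>s) + \<tau> * shannon_entropy ?\<mu>"
    by (simp add: r_def)
qed

text \<open>The weight \<tau> / 2 is chosen so that Pinsker's inequality turns the first term into
  exactly \<tau> times a divergence, which the payoff expansion then cancels.\<close>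

lemma young_scaled:
  fixes \<tau> c x y :: real
  assumes "\<tau> > 0"
  shows "c * (x * y) \<le> \<tau> / 2 * x\<^sup>2 + c\<^sup>2 / (2 * \<tau>) * y\<^sup>2"
proof -
  have "0 \<le> (\<tau> * x - c * y)\<^sup>2 / (2 * \<tau>)"
    using assms by simp
  then show ?thesis
    using assms by (simp add: power2_eq_square field_simps)
qed

section \<open>Exact identities and gap bounds around the equilibrium\<close>

locale regularized_game =
  fixes A :: "real ^ 'n ^ 'm" and \<tau> :: real and \<zeta>s :: "('m::finite, 'n::finite) policies"
  assumes tau_pos: "\<tau> > 0" and qre: "is_qre A \<tau> \<zeta>s"
begin

abbreviation N :: real where "N \<equiv> entry_norm A"

lemma qre_pos: "\<zeta>s \<in> pos_simplex \<times> pos_simplex"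
  using qre_fst[OF tau_pos qre] qre_snd[OF tau_pos qre] softmax_pos
  by (metis SigmaI prod.collapse)

lemma qre_fst_pos: "fst \<zeta>s \<in> pos_simplex" and qre_snd_pos: "snd \<zeta>s \<in> pos_simplex"
  using qre_pos by auto

lemma log_pair_qre:
  obtains c d where "\<tau> *\<^sub>R log_pair \<zeta>s = gradient A \<zeta>s + (vec c, vec d)"
proof -
  obtain c where "\<tau> *\<^sub>R log_vec (fst \<zeta>s) = A *v snd \<zeta>s + vec c"
    using log_vec_softmax[OF tau_pos] qre_fst[OF tau_pos qre] by metis
  moreover obtain d where "\<tau> *\<^sub>R log_vec (snd \<zeta>s) = - (transpose A *v fst \<zeta>s) + vec d"
    using log_vec_softmax[OF tau_pos] qre_snd[OF tau_pos qre] by metis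
  ultimately show thesis
    by (intro that[of c d]) (simp add: log_pair_def gradient_def prod_eq_iff)
qed

lemma log_pair_step:
  assumes "\<zeta> \<in> pos_simplex \<times> pos_simplex"
  obtains c d where "log_pair (both_step A \<tau> \<eta> \<zeta> \<xi>) = (1 - \<eta> * \<tau>) *\<^sub>R log_pair \<zeta>
    + (\<eta> * \<tau>) *\<^sub>R log_pair \<zeta>s + \<eta> *\<^sub>R gradient A (\<xi> - \<zeta>s) + (vec c, vec d)"
proof -
  obtain c d where 1: "log_pair (both_step A \<tau> \<eta> \<zeta> \<xi>) =
      (1 - \<eta> * \<tau>) *\<^sub>R log_pair \<zeta> + \<eta> *\<^sub>R gradient A \<xi> + (vec c, vec d)"
    using log_pair_both_step[OF assms] .
  obtain c' d' where 2: "\<tau> *\<^sub>R log_pair \<zeta>s = gradient A \<zeta>s + (vec c', vec d')"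
    using log_pair_qre .
  have "(\<eta> * \<tau>) *\<^sub>R log_pair \<zeta>s = \<eta> *\<^sub>R gradient A \<zeta>s + \<eta> *\<^sub>R (vec c', vec d')"
    using arg_cong[OF 2, of "scaleR \<eta>"] by (simp add: scaleR_add_right)
  then show thesis
    by (intro that[of "c - \<eta> * c'" "d - \<eta> * d'"])
      (simp add: 1 gradient_diff scaleR_diff_right, simp add: vec_eq_iff)
qed

text \<open>A three-point identity with a free reference pair \<open>z\<close>: pair the logarithmic
  form of the update with z - \<zeta>s. The choice of \<open>z\<close> as the midpoint comes
  later.\<close>

lemma KL_step_identity:
  assumes \<zeta>: "\<zeta> \<in> pos_simplex \<times> pos_simplex" and z: "z \<in> pos_simplex \<times> pos_simplex"
  shows "KL \<zeta>s (both_step A \<tau> \<eta> \<zeta> \<xi>) = (1 - \<eta> * \<tau>) * KL \<zeta>s \<zeta>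
    + \<eta> * (gradient A (\<xi> - \<zeta>s) \<bullet> (z - \<zeta>s))
    - (1 - \<eta> * \<tau>) * KL z \<zeta> - \<eta> * \<tau> * KL z \<zeta>s + KL z (both_step A \<tau> \<eta> \<zeta> \<xi>)"
proof -
  let ?w = "both_step A \<tau> \<eta> \<zeta> \<xi>"
  have w: "?w \<in> pos_simplex \<times> pos_simplex"
    using both_step_pos[OF \<zeta>] .
  obtain c d where L: "log_pair ?w = (1 - \<eta> * \<tau>) *\<^sub>R log_pair \<zeta>
    + (\<eta> * \<tau>) *\<^sub>R log_pair \<zeta>s + \<eta> *\<^sub>R gradient A (\<xi> - \<zeta>s) + (vec c, vec d)"
    using log_pair_step[OF \<zeta>] .
  define G where "G = gradient A (\<xi> - \<zeta>s) \<bullet> (z - \<zeta>s)"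
  have "log_pair ?w - (1 - \<eta> * \<tau>) *\<^sub>R log_pair \<zeta> - (\<eta> * \<tau>) *\<^sub>R log_pair \<zeta>s =
      \<eta> *\<^sub>R gradient A (\<xi> - \<zeta>s) + (vec c, vec d)"
    by (simp add: L)
  then have "(z - \<zeta>s) \<bullet> (log_pair ?w - (1 - \<eta> * \<tau>) *\<^sub>R log_pair \<zeta> - (\<eta> * \<tau>) *\<^sub>R log_pair \<zeta>s) = \<eta> * G"
    by (simp only: inner_add_right inner_scaleR_right G_def inner_commute[of "gradient _ _"] add_0_right
        pair_const_orthogonal[OF z[THEN pos_imp_simplex_pair] qre_pos[THEN pos_imp_simplex_pair]])
  \<comment> \<open>The coefficients 1, -(1 - \<eta> \<tau>) and -\<eta> \<tau> sum to zero, so the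
    entropies of \<open>z\<close> and \<zeta>s may be inserted and every term becomes a
    divergence.\<close>
  then show ?thesis
    unfolding KL_inner[OF qre_pos w] KL_inner[OF qre_pos \<zeta>] KL_inner[OF z \<zeta>]
      KL_inner[OF z qre_pos] KL_inner[OF z w] G_def[symmetric]
    by (simp add: inner_diff_left inner_diff_right algebra_simps)
qed

text \<open>Two updates from the same point share the term in \<zeta>, so their logarithms differ
  only by gradients and constants; the symmetrised divergence pairs this difference with z -
  w.\<close>

lemma KL_two_steps:
  assumes \<zeta>: "\<zeta> \<in> pos_simplex \<times> pos_simplex"
    and z_def: "z = both_step A \<tau> \<eta> \<zeta> \<xi>" and w_def: "w = both_step A \<tau> \<eta> \<zeta> \<xi>'"
  shows "KL z w + KL w z = \<eta> * (gradient A (\<xi> - \<xi>') \<bullet> (z - w))"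
proof -
  have z: "z \<in> pos_simplex \<times> pos_simplex" and w: "w \<in> pos_simplex \<times> pos_simplex"
    using both_step_pos[OF \<zeta>] by (simp_all add: z_def w_def)
  obtain c d where 1: "log_pair z =
      (1 - \<eta> * \<tau>) *\<^sub>R log_pair \<zeta> + \<eta> *\<^sub>R gradient A \<xi> + (vec c, vec d)"
    using log_pair_both_step[OF \<zeta>] unfolding z_def .
  obtain c' d' where 2: "log_pair w =
      (1 - \<eta> * \<tau>) *\<^sub>R log_pair \<zeta> + \<eta> *\<^sub>R gradient A \<xi>' + (vec c', vec d')"
    using log_pair_both_step[OF \<zeta>] unfolding w_def .
  have "log_pair z - log_pair w = \<eta> *\<^sub>R gradient A (\<xi> - \<xi>') + (vec (c - c'), vec (d - d'))"
    by (simp add: 1 2 gradient_diff scaleR_diff_right, simp add: vec_eq_iff)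
  then have "(z - w) \<bullet> (log_pair z - log_pair w) = \<eta> * (gradient A (\<xi> - \<xi>') \<bullet> (z - w))"
    by (simp only: inner_add_right inner_scaleR_right inner_commute[of "gradient _ _"] add_0_right
        pair_const_orthogonal[OF z[THEN pos_imp_simplex_pair] w[THEN pos_imp_simplex_pair]])
  moreover have "KL z w + KL w z = (z - w) \<bullet> (log_pair z - log_pair w)"
    unfolding KL_inner[OF z w] KL_inner[OF w z] by (simp add: inner_diff_left inner_diff_right)
  ultimately show ?thesis by simp
qed

text \<open>Moving one player alone away from equilibrium costs exactly \<tau> times a divergence,
  by the variational formula. The only interaction of the two deviations is bilinear.\<close>

lemma payoff_expansion:
  assumes "\<mu> \<in> prob_simplex" "\<nu> \<in> prob_simplex"
  shows "payoff A \<tau> \<mu> \<nu> = payoff A \<tau> (fst \<zeta>s) (snd \<zeta>s)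
    + (\<mu> - fst \<zeta>s) \<bullet> (A *v (\<nu> - snd \<zeta>s))
    - \<tau> * KL_vec \<mu> (fst \<zeta>s) + \<tau> * KL_vec \<nu> (snd \<zeta>s)"
proof -
  have "payoff A \<tau> \<mu> (snd \<zeta>s) = payoff A \<tau> (fst \<zeta>s) (snd \<zeta>s) - \<tau> * KL_vec \<mu> (fst \<zeta>s)"
    using gibbs_variational[OF tau_pos assms(1), of "A *v snd \<zeta>s"]
    unfolding payoff_def by (simp flip: qre_fst[OF tau_pos qre])
  moreover have "payoff A \<tau> (fst \<zeta>s) \<nu> = payoff A \<tau> (fst \<zeta>s) (snd \<zeta>s) + \<tau> * KL_vec \<nu> (snd \<zeta>s)"
    using gibbs_variational[OF tau_pos assms(2), of "- (transpose A *v fst \<zeta>s)"]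
    unfolding payoff_as_response qre_snd[OF tau_pos qre, symmetric] by linarith
  ultimately show ?thesis
    by (simp add: payoff_def matrix_vector_mult_diff_distrib inner_diff_left inner_diff_right)
qed

lemma opt_gap_le:
  assumes z: "z \<in> pos_simplex \<times> pos_simplex"
  shows "opt_gap A \<tau> \<zeta>s z \<le> N * KL \<zeta>s z + \<tau> * KL z \<zeta>s"
proof -
  have z': "fst z \<in> pos_simplex" "snd z \<in> pos_simplex" using z by auto
  note z'' = z'[THEN pos_simplex_imp_simplex]
  let ?b = "(fst z - fst \<zeta>s) \<bullet> (A *v (snd z - snd \<zeta>s))"
  have "\<bar>?b\<bar> \<le> N / 2 * l1_sq (z - \<zeta>s)"
    using bilinear_bound_sq[of "fst z - fst \<zeta>s" A "snd z - snd \<zeta>s"] by (simp add: l1_sq_def)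
  also have "\<dots> \<le> N / 2 * (2 * KL \<zeta>s z)"
    using pinsker_pair[OF qre_pos z] entry_norm_nonneg
    by (intro mult_left_mono) (simp_all add: l1_sq_minus_commute)
  finally have "\<bar>?b\<bar> \<le> N * KL \<zeta>s z" by simp
  \<comment> \<open>The two players' divergences enter the payoff with opposite signs, so the
    absolute value is bounded by their sum.\<close>
  moreover have "0 \<le> \<tau> * KL_vec (fst z) (fst \<zeta>s)" "0 \<le> \<tau> * KL_vec (snd z) (snd \<zeta>s)"
    using KL_vec_nonneg[OF z''(1) qre_fst_pos] KL_vec_nonneg[OF z''(2) qre_snd_pos] tau_pos
    by simp_all
  ultimately show ?thesis
    unfolding opt_gap_def payoff_expansion[OF z''] KL_def[of z \<zeta>s] distrib_left by linarith
qed

text \<open>The competitor's own divergence from equilibrium, entering with the favourable sign,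
  pays for its part of the bilinear term. What remains is independent of the competitor.\<close>

lemma dual_gap_le:
  assumes z: "z \<in> pos_simplex \<times> pos_simplex"
  shows "dual_gap A \<tau> z \<le> N\<^sup>2 / \<tau> * KL \<zeta>s z + \<tau> * KL z \<zeta>s"
proof -
  have z': "fst z \<in> pos_simplex" "snd z \<in> pos_simplex" using z by auto
  note z'' = z'[THEN pos_simplex_imp_simplex]
  let ?v = "payoff A \<tau> (fst \<zeta>s) (snd \<zeta>s)"
  have ne: "prob_simplex \<noteq> ({} :: (real ^ 'm) set)" "prob_simplex \<noteq> ({} :: (real ^ 'n) set)"
    using z'' by auto
  have "(SUP \<mu>\<in>prob_simplex. payoff A \<tau> \<mu> (snd z))
      \<le> ?v + N\<^sup>2 / \<tau> * KL_vec (snd \<zeta>s) (snd z) + \<tau> * KL_vec (snd z) (snd \<zeta>s)"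
  proof (rule cSUP_least[OF ne(1)])
    fix \<mu> :: "real ^ 'm" assume mu: "\<mu> \<in> prob_simplex"
    have "(\<mu> - fst \<zeta>s) \<bullet> (A *v (snd z - snd \<zeta>s)) \<le>
        \<tau> / 2 * (l1_norm (\<mu> - fst \<zeta>s))\<^sup>2 + N\<^sup>2 / (2 * \<tau>) * (l1_norm (snd z - snd \<zeta>s))\<^sup>2"
      using bilinear_bound[of "\<mu> - fst \<zeta>s" A "snd z - snd \<zeta>s"]
        young_scaled[OF tau_pos, of N "l1_norm (\<mu> - fst \<zeta>s)" "l1_norm (snd z - snd \<zeta>s)"] by linarith
    also have "\<dots> \<le> \<tau> / 2 * (2 * KL_vec \<mu> (fst \<zeta>s)) + N\<^sup>2 / (2 * \<tau>) * (2 * KL_vec (snd \<zeta>s) (snd z))"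
      using pinsker[OF mu qre_fst_pos] tau_pos
        pinsker[OF pos_simplex_imp_simplex[OF qre_snd_pos] z'(2)]
      by (intro add_mono mult_left_mono) (simp_all add: l1_norm_minus_commute)
    finally show "payoff A \<tau> \<mu> (snd z)
        \<le> ?v + N\<^sup>2 / \<tau> * KL_vec (snd \<zeta>s) (snd z) + \<tau> * KL_vec (snd z) (snd \<zeta>s)"
      by (simp add: payoff_expansion[OF mu z''(2)])
  qed
  moreover have "?v - N\<^sup>2 / \<tau> * KL_vec (fst \<zeta>s) (fst z) - \<tau> * KL_vec (fst z) (fst \<zeta>s)
      \<le> (INF \<nu>\<in>prob_simplex. payoff A \<tau> (fst z) \<nu>)"
  proof (rule cINF_greatest[OF ne(2)])
    fix \<nu> :: "real ^ 'n" assume nu: "\<nu> \<in> prob_simplex"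
    have "- ((fst z - fst \<zeta>s) \<bullet> (A *v (\<nu> - snd \<zeta>s))) \<le>
        N\<^sup>2 / (2 * \<tau>) * (l1_norm (fst z - fst \<zeta>s))\<^sup>2 + \<tau> / 2 * (l1_norm (\<nu> - snd \<zeta>s))\<^sup>2"
      using bilinear_bound[of "fst z - fst \<zeta>s" A "\<nu> - snd \<zeta>s"]
        young_scaled[OF tau_pos, of N "l1_norm (\<nu> - snd \<zeta>s)" "l1_norm (fst z - fst \<zeta>s)"]
      by (simp only: mult.commute[of "l1_norm (\<nu> - snd \<zeta>s)"])
    also have "\<dots> \<le> N\<^sup>2 / (2 * \<tau>) * (2 * KL_vec (fst \<zeta>s) (fst z)) + \<tau> / 2 * (2 * KL_vec \<nu> (snd \<zeta>s))"
      using pinsker[OF nu qre_snd_pos] tau_pos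
        pinsker[OF pos_simplex_imp_simplex[OF qre_fst_pos] z'(1)]
      by (intro add_mono mult_left_mono) (simp_all add: l1_norm_minus_commute)
    finally show "?v - N\<^sup>2 / \<tau> * KL_vec (fst \<zeta>s) (fst z) - \<tau> * KL_vec (fst z) (fst \<zeta>s)
        \<le> payoff A \<tau> (fst z) \<nu>"
      by (simp add: payoff_expansion[OF z''(1) nu])
  qed
  ultimately show ?thesis
    unfolding dual_gap_def KL_def distrib_left by linarith
qed

text \<open>The midpoint \<open>z\<close> serves as reference. For \<open>w\<close> the gradient
  term vanishes by skewness and \<open>KL_two_steps\<close> trades \<open>KL z w\<close> for
  \<open>- KL w z\<close>; for \<open>z\<close> itself the last divergence is
  \<open>KL z z = 0\<close>.\<close>

lemma extragradient_identities:
  assumes \<zeta>: "\<zeta> \<in> pos_simplex \<times> pos_simplex"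
    and z_def: "z = both_step A \<tau> \<eta> \<zeta> \<xi>" and w_def: "w = both_step A \<tau> \<eta> \<zeta> z"
  shows "KL \<zeta>s w = (1 - \<eta> * \<tau>) * KL \<zeta>s \<zeta> - (1 - \<eta> * \<tau>) * KL z \<zeta> - \<eta> * \<tau> * KL z \<zeta>s
      - KL w z + \<eta> * (gradient A (\<xi> - z) \<bullet> (z - w))"
    and "KL \<zeta>s z = (1 - \<eta> * \<tau>) * KL \<zeta>s \<zeta> - (1 - \<eta> * \<tau>) * KL z \<zeta> - \<eta> * \<tau> * KL z \<zeta>s
      + \<eta> * (gradient A (\<xi> - z) \<bullet> (z - \<zeta>s))"
proof -
  have z: "z \<in> pos_simplex \<times> pos_simplex"
    using both_step_pos[OF \<zeta>] by (simp only: z_def)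
  show "KL \<zeta>s w = (1 - \<eta> * \<tau>) * KL \<zeta>s \<zeta> - (1 - \<eta> * \<tau>) * KL z \<zeta> - \<eta> * \<tau> * KL z \<zeta>s
      - KL w z + \<eta> * (gradient A (\<xi> - z) \<bullet> (z - w))"
    using KL_step_identity[OF \<zeta> z, of \<eta> z, folded w_def] KL_two_steps[OF \<zeta> z_def w_def]
    by (simp only: gradient_inner_self mult_zero_right)
  have "gradient A (\<xi> - \<zeta>s) = gradient A (\<xi> - z) + gradient A (z - \<zeta>s)"
    by (simp add: gradient_diff)
  then have eq: "gradient A (\<xi> - \<zeta>s) \<bullet> (z - \<zeta>s) = gradient A (\<xi> - z) \<bullet> (z - \<zeta>s)"
    by (simp only: inner_add_left gradient_inner_self add_0_right)
  show "KL \<zeta>s z = (1 - \<eta> * \<tau>) * KL \<zeta>s \<zeta> - (1 - \<eta> * \<tau>) * KL z \<zeta> - \<eta> * \<tau> * KL z \<zeta>s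
      + \<eta> * (gradient A (\<xi> - z) \<bullet> (z - \<zeta>s))"
    using KL_step_identity[OF \<zeta> z, of \<eta> \<xi>, folded z_def] unfolding KL_self[OF z] eq by linarith
qed

section \<open>Potential functions for PU and OMWU\<close>

lemma gradient_diff_inner_le:
  assumes "x \<in> pos_simplex \<times> pos_simplex" "y \<in> pos_simplex \<times> pos_simplex" "l1_sq b \<le> 2 * k"
  shows "gradient A (x - y) \<bullet> b \<le> N * (KL y x + k)"
proof -
  have "gradient A (x - y) \<bullet> b \<le> N / 2 * (l1_sq (x - y) + l1_sq b)"
    using gradient_inner_bound[of A "x - y" b] by linarith
  also have "\<dots> \<le> N / 2 * (2 * KL y x + 2 * k)"
    using pinsker_pair[OF assms(2,1)] assms(3) entry_norm_nonneg[of A]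
    by (intro mult_left_mono) (simp_all add: l1_sq_minus_commute)
  finally show ?thesis by (simp add: algebra_simps)
qed

text \<open>The interface through which both methods yield rates. The dissipation in the last clause
  is retained because it controls the reverse divergence
  \<open>KL (\<zeta>b (Suc t)) \<zeta>s\<close> in the gap bounds.\<close>

definition lyapunov :: "real \<Rightarrow> (nat \<Rightarrow> ('m, 'n) policies) \<Rightarrow> (nat \<Rightarrow> ('m, 'n) policies) \<Rightarrow> (nat \<Rightarrow> real) \<Rightarrow> bool" where
  "lyapunov \<eta> \<zeta> \<zeta>b L \<longleftrightarrow> L 0 = KL \<zeta>s (\<zeta> 0) \<and>
    (\<forall>t. KL \<zeta>s (\<zeta> t) \<le> L t \<and> KL \<zeta>s (\<zeta>b (Suc t)) \<le> 2 * ((1 - \<eta> * \<tau>) * L t) \<and>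
      L (Suc t) + \<eta> * \<tau> * KL (\<zeta>b (Suc t)) \<zeta>s \<le> (1 - \<eta> * \<tau>) * L t)"

lemma lyapunov_PU:
  assumes PU: "is_PU A \<tau> (\<lambda>_. \<eta>) \<zeta> \<zeta>b" and pos: "\<And>t. \<zeta> t \<in> pos_simplex \<times> pos_simplex"
    and \<eta>: "0 < \<eta>" "\<eta> * \<tau> + 2 * (\<eta> * N) \<le> 1"
  shows "lyapunov \<eta> \<zeta> \<zeta>b (\<lambda>t. KL \<zeta>s (\<zeta> t))"
  unfolding lyapunov_def
proof (intro conjI allI refl order_refl)
  fix t
  let ?z = "\<zeta>b (Suc t)" and ?w = "\<zeta> (Suc t)"
  have z_def: "?z = both_step A \<tau> \<eta> (\<zeta> t) (\<zeta> t)" and w_def: "?w = both_step A \<tau> \<eta> (\<zeta> t) ?z"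
    using PU by (simp_all add: is_PU_def)
  have z: "?z \<in> pos_simplex \<times> pos_simplex"
    unfolding z_def by (rule both_step_pos[OF pos])
  note ids = extragradient_identities[OF pos z_def w_def]
  have x: "0 \<le> \<eta> * N" "0 < \<eta> * \<tau>"
    using \<eta>(1) entry_norm_nonneg[of A] tau_pos by simp_all
  \<comment> \<open>\<open>n1\<close> and \<open>n2\<close> say that the negative divergences absorb
    the remainder. \<open>n3\<close> keeps at least half of \<open>KL \<zeta>s ?z\<close> on the
    left, whence the factor 2 in the midpoint bound.\<close>
  have n1: "0 \<le> (1 - \<eta> * \<tau> - \<eta> * N) * KL ?z (\<zeta> t)"
    using x \<eta>(2) KL_nonneg[OF z pos] by (intro mult_nonneg_nonneg) auto
  have n2: "0 \<le> (1 - \<eta> * N) * KL ?w ?z"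
    using x \<eta>(2) KL_nonneg[OF pos z] by (intro mult_nonneg_nonneg) auto
  have n3: "0 \<le> (1 / 2 - \<eta> * N) * KL \<zeta>s ?z"
    using x \<eta>(2) KL_nonneg[OF qre_pos z] by (intro mult_nonneg_nonneg) auto
  have n4: "0 \<le> \<eta> * \<tau> * KL ?z \<zeta>s"
    using x KL_nonneg[OF z qre_pos] by simp
  have "\<eta> * (gradient A (\<zeta> t - ?z) \<bullet> (?z - ?w)) \<le> \<eta> * (N * (KL ?z (\<zeta> t) + KL ?w ?z))"
    using gradient_diff_inner_le[OF pos z, of "?z - ?w"] pinsker_pair[OF pos z, of "Suc t"] \<eta>(1)
    by (intro mult_left_mono) (simp_all add: l1_sq_minus_commute)
  then have "KL \<zeta>s ?w \<le> (1 - \<eta> * \<tau>) * KL \<zeta>s (\<zeta> t) - (1 - \<eta> * \<tau>) * KL ?z (\<zeta> t) - \<eta> * \<tau> * KL ?z \<zeta>s - KL ?w ?z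
      + \<eta> * (N * (KL ?z (\<zeta> t) + KL ?w ?z))"
    using ids(1) by linarith
  then show "KL \<zeta>s ?w + \<eta> * \<tau> * KL ?z \<zeta>s \<le> (1 - \<eta> * \<tau>) * KL \<zeta>s (\<zeta> t)"
    using n1 n2 by (simp add: algebra_simps)
  have "\<eta> * (gradient A (\<zeta> t - ?z) \<bullet> (?z - \<zeta>s)) \<le> \<eta> * (N * (KL ?z (\<zeta> t) + KL \<zeta>s ?z))"
    using gradient_diff_inner_le[OF pos z, of "?z - \<zeta>s"] pinsker_pair[OF qre_pos z] \<eta>(1)
    by (intro mult_left_mono) (simp_all add: l1_sq_minus_commute)
  then have "KL \<zeta>s ?z \<le> (1 - \<eta> * \<tau>) * KL \<zeta>s (\<zeta> t) - (1 - \<eta> * \<tau>) * KL ?z (\<zeta> t) - \<eta> * \<tau> * KL ?z \<zeta>s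
      + \<eta> * (N * (KL ?z (\<zeta> t) + KL \<zeta>s ?z))"
    using ids(2) by linarith
  then show "KL \<zeta>s ?z \<le> 2 * ((1 - \<eta> * \<tau>) * KL \<zeta>s (\<zeta> t))"
    using n1 n3 n4 by (simp add: algebra_simps)
qed

text \<open>The midpoint uses the gradient at the old midpoint, so the error is split through
  \<open>\<zeta> t\<close> and costs an extra
  \<open>\<eta> * N * KL (\<zeta> t) (\<zeta>b t)\<close>. The potential stores a reserve for it:
  after \<open>2 * (\<eta> * N)\<close> of \<open>KL (\<zeta> (Suc t)) (\<zeta>b (Suc t))\<close> is
  spent on the remainder, the rest is carried to the next step.\<close>

lemma lyapunov_OMWU:
  assumes OMWU: "is_OMWU A \<tau> (\<lambda>_. \<eta>) \<zeta> \<zeta>b"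
    and pos: "\<And>t. \<zeta> t \<in> pos_simplex \<times> pos_simplex" "\<And>t. \<zeta>b t \<in> pos_simplex \<times> pos_simplex"
    and \<eta>: "0 < \<eta>" "\<eta> * \<tau> + \<eta> * N \<le> 1 / 2" "\<eta> * N \<le> 1 / 4"
  shows "lyapunov \<eta> \<zeta> \<zeta>b (\<lambda>t. KL \<zeta>s (\<zeta> t) + (1 - 2 * (\<eta> * N)) * KL (\<zeta> t) (\<zeta>b t))"
  unfolding lyapunov_def
proof (intro conjI allI)
  \<comment> \<open>The reserve is zero initially because \<open>\<zeta>b 0 = \<zeta> 0\<close>, so
    the rate starts from \<open>KL \<zeta>s (\<zeta> 0)\<close> alone.\<close>
  show "KL \<zeta>s (\<zeta> 0) + (1 - 2 * (\<eta> * N)) * KL (\<zeta> 0) (\<zeta>b 0) = KL \<zeta>s (\<zeta> 0)"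
    using OMWU KL_self[OF pos(1)] by (simp add: is_OMWU_def)
  fix t
  let ?y = "\<zeta>b t" and ?z = "\<zeta>b (Suc t)" and ?w = "\<zeta> (Suc t)"
  have z_def: "?z = both_step A \<tau> \<eta> (\<zeta> t) ?y" and w_def: "?w = both_step A \<tau> \<eta> (\<zeta> t) ?z"
    using OMWU by (simp_all add: is_OMWU_def)
  note ids = extragradient_identities[OF pos(1) z_def w_def]
  have x: "0 \<le> \<eta> * N" "0 < \<eta> * \<tau>"
    using \<eta>(1) entry_norm_nonneg[of A] tau_pos by simp_all
  show "KL \<zeta>s (\<zeta> t) \<le> KL \<zeta>s (\<zeta> t) + (1 - 2 * (\<eta> * N)) * KL (\<zeta> t) ?y"
    using \<eta>(3) KL_nonneg[OF pos(1) pos(2)] by simp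
  \<comment> \<open>With x = \<eta> N the left side is 1/2 - 2 x^2, which is at least 1/2 - x/2 and
    hence at least x, as x \<le> 1/4. The contracted reserve therefore covers the extra
    cost.\<close>
  have "(1 / 2 + \<eta> * N) * (1 - 2 * (\<eta> * N)) \<le> (1 - \<eta> * \<tau>) * (1 - 2 * (\<eta> * N))"
    using \<eta> by (intro mult_right_mono) auto
  moreover have "\<eta> * N * (\<eta> * N) \<le> \<eta> * N * (1 / 4)"
    using \<eta> x by (intro mult_left_mono) auto
  ultimately have "\<eta> * N \<le> (1 - \<eta> * \<tau>) * (1 - 2 * (\<eta> * N))"
    using \<eta>(3) by (simp add: algebra_simps)
  then have n0: "\<eta> * N * KL (\<zeta> t) ?y \<le> (1 - \<eta> * \<tau>) * (1 - 2 * (\<eta> * N)) * KL (\<zeta> t) ?y"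
    by (intro mult_right_mono KL_nonneg pos)
  have n1: "0 \<le> (1 - \<eta> * \<tau> - \<eta> * N) * KL ?z (\<zeta> t)"
    using x \<eta> KL_nonneg[OF pos(2) pos(1)] by (intro mult_nonneg_nonneg) auto
  have n3: "0 \<le> (1 / 4 - \<eta> * N) * KL \<zeta>s ?z"
    using x \<eta> KL_nonneg[OF qre_pos pos(2)] by (intro mult_nonneg_nonneg) auto
  have n4: "0 \<le> \<eta> * \<tau> * KL ?z \<zeta>s"
    using x KL_nonneg[OF pos(2) qre_pos] by simp
  have split: "\<eta> * (gradient A (?y - ?z) \<bullet> b) \<le> \<eta> * N * (KL (\<zeta> t) ?y + KL ?z (\<zeta> t) + 2 * k)"
    if "l1_sq b \<le> 2 * k" for b k
  proof -
    have "gradient A (?y - ?z) \<bullet> b = gradient A (?y - \<zeta> t) \<bullet> b + gradient A (\<zeta> t - ?z) \<bullet> b"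
      by (simp add: gradient_diff inner_diff_left)
    also have "\<dots> \<le> N * (KL (\<zeta> t) ?y + k) + N * (KL ?z (\<zeta> t) + k)"
      by (intro add_mono gradient_diff_inner_le pos that)
    finally have "\<eta> * (gradient A (?y - ?z) \<bullet> b)
        \<le> \<eta> * (N * (KL (\<zeta> t) ?y + k) + N * (KL ?z (\<zeta> t) + k))"
      using \<eta>(1) by (intro mult_left_mono) auto
    then show ?thesis by (simp add: algebra_simps)
  qed
  have "\<eta> * (gradient A (?y - ?z) \<bullet> (?z - ?w)) \<le> \<eta> * N * (KL (\<zeta> t) ?y + KL ?z (\<zeta> t) + 2 * KL ?w ?z)"
    using pinsker_pair[OF pos(1) pos(2), of "Suc t" "Suc t"] by (intro split) (simp add: l1_sq_minus_commute)
  then have "KL \<zeta>s ?w \<le> (1 - \<eta> * \<tau>) * KL \<zeta>s (\<zeta> t) - (1 - \<eta> * \<tau>) * KL ?z (\<zeta> t) - \<eta> * \<tau> * KL ?z \<zeta>s - KL ?w ?z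
      + \<eta> * N * (KL (\<zeta> t) ?y + KL ?z (\<zeta> t) + 2 * KL ?w ?z)"
    using ids(1) by linarith
  then show "KL \<zeta>s ?w + (1 - 2 * (\<eta> * N)) * KL ?w ?z + \<eta> * \<tau> * KL ?z \<zeta>s
      \<le> (1 - \<eta> * \<tau>) * (KL \<zeta>s (\<zeta> t) + (1 - 2 * (\<eta> * N)) * KL (\<zeta> t) ?y)"
    using n0 n1 by (simp add: algebra_simps)
  have "\<eta> * (gradient A (?y - ?z) \<bullet> (?z - \<zeta>s)) \<le> \<eta> * N * (KL (\<zeta> t) ?y + KL ?z (\<zeta> t) + 2 * KL \<zeta>s ?z)"
    using pinsker_pair[OF qre_pos pos(2), of "Suc t"] by (intro split) (simp add: l1_sq_minus_commute)
  then have "KL \<zeta>s ?z \<le> (1 - \<eta> * \<tau>) * KL \<zeta>s (\<zeta> t) - (1 - \<eta> * \<tau>) * KL ?z (\<zeta> t) - \<eta> * \<tau> * KL ?z \<zeta>s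
      + \<eta> * N * (KL (\<zeta> t) ?y + KL ?z (\<zeta> t) + 2 * KL \<zeta>s ?z)"
    using ids(2) by linarith
  then show "KL \<zeta>s ?z \<le> 2 * ((1 - \<eta> * \<tau>) * (KL \<zeta>s (\<zeta> t) + (1 - 2 * (\<eta> * N)) * KL (\<zeta> t) ?y))"
    using n0 n1 n3 n4 by (simp add: algebra_simps)
qed

text \<open>Midpoint and reverse divergence are bounded by the already contracted potential, hence
  the exponent \<open>Suc t\<close>. The extra factor over \<open>t\<close> is what the optimality
  gap needs.\<close>

lemma lyapunov_rates:
  assumes L: "lyapunov \<eta> \<zeta> \<zeta>b L" and \<eta>: "0 < \<eta>" "\<eta> * \<tau> \<le> 1"
    and pos: "\<And>t. \<zeta> t \<in> pos_simplex \<times> pos_simplex" "\<And>t. \<zeta>b (Suc t) \<in> pos_simplex \<times> pos_simplex"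
  shows "KL \<zeta>s (\<zeta> t) \<le> (1 - \<eta> * \<tau>) ^ t * KL \<zeta>s (\<zeta> 0)"
    and "KL \<zeta>s (\<zeta>b (Suc t)) \<le> 2 * ((1 - \<eta> * \<tau>) ^ Suc t * KL \<zeta>s (\<zeta> 0))"
    and "\<eta> * \<tau> * KL (\<zeta>b (Suc t)) \<zeta>s \<le> (1 - \<eta> * \<tau>) ^ Suc t * KL \<zeta>s (\<zeta> 0)"
proof -
  have L0: "L 0 = KL \<zeta>s (\<zeta> 0)" and L1: "KL \<zeta>s (\<zeta> t) \<le> L t"
    and L2: "KL \<zeta>s (\<zeta>b (Suc t)) \<le> 2 * ((1 - \<eta> * \<tau>) * L t)"
    and L3: "L (Suc t) + \<eta> * \<tau> * KL (\<zeta>b (Suc t)) \<zeta>s \<le> (1 - \<eta> * \<tau>) * L t" for t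
    using L by (auto simp: lyapunov_def)
  have q: "0 \<le> 1 - \<eta> * \<tau>" using \<eta> by simp
  have nn: "0 \<le> \<eta> * \<tau> * KL (\<zeta>b (Suc t)) \<zeta>s" for t
    using \<eta>(1) tau_pos KL_nonneg[OF pos(2) qre_pos] by simp
  have rate: "L t \<le> (1 - \<eta> * \<tau>) ^ t * KL \<zeta>s (\<zeta> 0)" for t
  proof (induction t)
    case 0
    show ?case by (simp add: L0)
  next
    case (Suc t)
    have "L (Suc t) \<le> (1 - \<eta> * \<tau>) * L t"
      using L3[of t] nn[of t] by linarith
    also have "\<dots> \<le> (1 - \<eta> * \<tau>) * ((1 - \<eta> * \<tau>) ^ t * KL \<zeta>s (\<zeta> 0))"
      using Suc.IH q by (rule mult_left_mono)
    finally show ?case by (simp add: mult.assoc)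
  qed
  have rate': "(1 - \<eta> * \<tau>) * L t \<le> (1 - \<eta> * \<tau>) ^ Suc t * KL \<zeta>s (\<zeta> 0)"
    using mult_left_mono[OF rate[of t] q] by (simp add: mult.assoc)
  show "KL \<zeta>s (\<zeta> t) \<le> (1 - \<eta> * \<tau>) ^ t * KL \<zeta>s (\<zeta> 0)"
    using L1 rate order_trans by blast
  show "KL \<zeta>s (\<zeta>b (Suc t)) \<le> 2 * ((1 - \<eta> * \<tau>) ^ Suc t * KL \<zeta>s (\<zeta> 0))"
    using L2[of t] rate' by linarith
  have "0 \<le> L (Suc t)"
    using L1[of "Suc t"] KL_nonneg[OF qre_pos pos(1), of "Suc t"] by linarith
  then show "\<eta> * \<tau> * KL (\<zeta>b (Suc t)) \<zeta>s \<le> (1 - \<eta> * \<tau>) ^ Suc t * KL \<zeta>s (\<zeta> 0)"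
    using L3[of t] rate' by linarith
qed

end

subsection \<open>Entrywise log-ratios\<close>

text \<open>Two vectors of equal mass cannot be strictly ordered in all coordinates, so the
  log-ratio is nonpositive somewhere and nonnegative somewhere; each entry is then within the span
  of zero.\<close>

lemma abs_log_ratio_le_span:
  fixes p s :: "real ^ 'k"
  assumes p: "p \<in> pos_simplex" and s: "s \<in> pos_simplex"
    and span: "\<And>i j. (log_vec p - log_vec s) $ i - (log_vec p - log_vec s) $ j \<le> S"
  shows "\<bar>ln (p $ i / s $ i)\<bar> \<le> S"
proof -
  have ex: "\<exists>j. v $ j \<le> u $ j" if "v \<in> pos_simplex" "u \<in> pos_simplex" for v u :: "real ^ 'k"
  proof (rule ccontr)
    assume "\<not> ?thesis"
    then have "(\<Sum>j\<in>UNIV. u $ j) < (\<Sum>j\<in>UNIV. v $ j)"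
      by (intro sum_strict_mono) (auto simp: not_le)
    then show False
      using that by (simp add: prob_simplex_sum pos_simplex_imp_simplex)
  qed
  have pos: "0 < p $ j" "0 < s $ j" for j
    using p s by (auto intro: pos_simplex_pos)
  obtain j k where "p $ j \<le> s $ j" "s $ k \<le> p $ k"
    using ex[OF p s] ex[OF s p] by blast
  then have "ln (p $ j) \<le> ln (s $ j)" "ln (s $ k) \<le> ln (p $ k)"
    using pos by simp_all
  moreover have "ln (p $ i / s $ i) = ln (p $ i) - ln (s $ i)"
    using pos[of i] by (simp add: ln_div)
  ultimately show ?thesis
    using span[of i j] span[of k i] by (simp add: abs_le_iff)
qed

lemma span_affine_step:
  fixes u v g :: "real ^ 'k"
  assumes "v = q *\<^sub>R u + h *\<^sub>R g + vec c" "0 \<le> q" "0 \<le> h"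
    and "\<And>i. \<bar>g $ i\<bar> \<le> G" "\<And>i j. u $ i - u $ j \<le> S"
  shows "v $ i - v $ j \<le> q * S + 2 * h * G"
proof -
  have "v $ i - v $ j = q * (u $ i - u $ j) + h * (g $ i - g $ j)"
    by (simp add: assms(1) algebra_simps)
  also have "\<dots> \<le> q * S + h * (2 * G)"
    using assms(4)[of i] assms(4)[of j] by (intro add_mono mult_left_mono assms(2,3,5)) linarith
  finally show ?thesis by simp
qed

lemma infnorm_pair_le:
  fixes z :: "('m::finite, 'n::finite) policies"
  assumes "\<And>a. \<bar>fst z $ a\<bar> \<le> B" "\<And>b. \<bar>snd z $ b\<bar> \<le> B"
  shows "infnorm z \<le> B"
proof -
  have "\<bar>z \<bullet> b\<bar> \<le> B" if "b \<in> Basis" for b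
    using that assms by (auto simp: Basis_prod_def Basis_vec_def inner_prod_def inner_axis)
  then show ?thesis
    by (simp add: infnorm_Max)
qed

lemma component_le_infnorm_pair:
  fixes z :: "('m::finite, 'n::finite) policies"
  shows "\<bar>fst z $ a\<bar> \<le> infnorm z" "\<bar>snd z $ b\<bar> \<le> infnorm z"
proof -
  have "(axis a 1, 0) \<in> (Basis :: ('m, 'n) policies set)" "(0, axis b 1) \<in> (Basis :: ('m, 'n) policies set)"
    by (auto simp: Basis_prod_def Basis_vec_def)
  from this[THEN Basis_le_infnorm[of _ z]]
  show "\<bar>fst z $ a\<bar> \<le> infnorm z" "\<bar>snd z $ b\<bar> \<le> infnorm z"
    by (simp_all add: inner_prod_def inner_axis)
qed

context regularized_game
begin

text \<open>The span obeys an affine recursion with factor q = 1 - \<eta> \<tau> and forcing from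
  the midpoint error, which decays only like sqrt(q)^t. \<open>B\<close> dominates this recursion
  and combines both rates.\<close>

lemma log_ratio_bound:
  assumes \<eta>: "0 < \<eta>" "\<eta> * \<tau> \<le> 1" and K: "0 \<le> K"
    and pos: "\<And>t. \<zeta> t \<in> pos_simplex \<times> pos_simplex" "\<And>t. \<zeta>b (Suc t) \<in> pos_simplex \<times> pos_simplex"
    and step: "\<And>t. \<zeta> (Suc t) = both_step A \<tau> \<eta> (\<zeta> t) (\<zeta>b (Suc t))"
    and mid: "\<And>t. KL \<zeta>s (\<zeta>b (Suc t)) \<le> 2 * ((1 - \<eta> * \<tau>) ^ Suc t * K)"
  shows "infnorm (log_ratio (\<zeta> t) \<zeta>s) \<le> 2 * (1 - \<eta> * \<tau>) ^ t * infnorm (log_ratio (\<zeta> 0) \<zeta>s)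
    + 8 * N / \<tau> * sqrt ((1 - \<eta> * \<tau>) ^ t) * sqrt K"
proof -
  define q where "q = 1 - \<eta> * \<tau>"
  define W where "W = infnorm (log_ratio (\<zeta> 0) \<zeta>s)"
  define B where "B t = 2 * q ^ t * W + 8 * N / \<tau> * sqrt (q ^ t) * sqrt K" for t
  let ?u = "\<lambda>t. log_vec (fst (\<zeta> t)) - log_vec (fst \<zeta>s)"
  let ?v = "\<lambda>t. log_vec (snd (\<zeta> t)) - log_vec (snd \<zeta>s)"
  have q: "0 \<le> q" using \<eta> by (simp add: q_def)
  have pos': "fst (\<zeta> t) \<in> pos_simplex" "snd (\<zeta> t) \<in> pos_simplex" for t
    using pos(1)[of t] by auto
  have lr: "fst (log_ratio (\<zeta> t) \<zeta>s) = ?u t" "snd (log_ratio (\<zeta> t) \<zeta>s) = ?v t" for t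
    using pos'[of t, THEN pos_simplex_pos] qre_fst_pos[THEN pos_simplex_pos] qre_snd_pos[THEN pos_simplex_pos]
    by (simp_all add: log_ratio_def vec_eq_iff ln_div less_imp_neq[symmetric])
  define r where "r = sqrt q"
  have r: "0 \<le> r" "r * r = q" "r \<le> 1"
    using q \<eta>(1) tau_pos by (simp_all add: r_def q_def)
  have Bstep: "q * B t + 2 * \<eta> * (N * (2 * (sqrt (q ^ Suc t) * sqrt K))) \<le> B (Suc t)" for t
  proof -
    define X where "X = N * sqrt (q ^ t) * sqrt K"
    have X: "0 \<le> X" using K q entry_norm_nonneg[of A] by (simp add: X_def)
    \<comment> \<open>Origin of the constant 8: the forcing carries 4 \<eta>, and \<eta> \<tau> = 1
      - r^2 \<le> 2 (1 - r) bounds it by (8 / \<tau>) (1 - r), the amount by which the slower mode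
      exceeds the faster one.\<close>
    have "\<eta> * \<tau> = (1 - r) * (1 + r)"
      using r(2) by (simp add: q_def algebra_simps)
    also have "\<dots> \<le> (1 - r) * 2"
      using r by (intro mult_left_mono) auto
    finally have "4 * \<eta> \<le> 8 / \<tau> * (1 - r)"
      using tau_pos by (simp add: field_simps)
    then have "r * X * (4 * \<eta>) \<le> r * X * (8 / \<tau> * (1 - r))"
      using r X by (intro mult_left_mono) auto
    then have "r * r * (8 / \<tau> * X) + 4 * \<eta> * (r * X) \<le> 8 / \<tau> * (r * X)"
      by (simp add: algebra_simps diff_divide_distrib)
    moreover have "sqrt (q ^ Suc t) = r * sqrt (q ^ t)"
      by (simp add: real_sqrt_mult r_def)
    ultimately show ?thesis
      by (simp add: B_def X_def r(2) algebra_simps)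
  qed
  have l1: "l1_norm (fst (\<zeta>b (Suc t) - \<zeta>s)) \<le> 2 * (sqrt (q ^ Suc t) * sqrt K)"
    "l1_norm (snd (\<zeta>b (Suc t) - \<zeta>s)) \<le> 2 * (sqrt (q ^ Suc t) * sqrt K)" for t
  proof -
    have "l1_sq (\<zeta>b (Suc t) - \<zeta>s) \<le> 2 * KL \<zeta>s (\<zeta>b (Suc t))"
      using pinsker_pair[OF qre_pos pos(2)] by (simp only: l1_sq_minus_commute)
    also have "\<dots> \<le> 4 * (q ^ Suc t * K)"
      using mid[of t] unfolding q_def by linarith
    also have "\<dots> = (2 * (sqrt (q ^ Suc t) * sqrt K))\<^sup>2"
      using K q by (simp add: power_mult_distrib)
    finally have "(l1_norm (fst (\<zeta>b (Suc t) - \<zeta>s)))\<^sup>2 + (l1_norm (snd (\<zeta>b (Suc t) - \<zeta>s)))\<^sup>2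
        \<le> (2 * (sqrt (q ^ Suc t) * sqrt K))\<^sup>2"
      by (simp only: l1_sq_def)
    then have sq: "(l1_norm (fst (\<zeta>b (Suc t) - \<zeta>s)))\<^sup>2 \<le> (2 * (sqrt (q ^ Suc t) * sqrt K))\<^sup>2"
      "(l1_norm (snd (\<zeta>b (Suc t) - \<zeta>s)))\<^sup>2 \<le> (2 * (sqrt (q ^ Suc t) * sqrt K))\<^sup>2"
      by (smt (verit) zero_le_power2)+
    have D: "0 \<le> 2 * (sqrt (q ^ Suc t) * sqrt K)"
      using K q by simp
    show "l1_norm (fst (\<zeta>b (Suc t) - \<zeta>s)) \<le> 2 * (sqrt (q ^ Suc t) * sqrt K)"
      "l1_norm (snd (\<zeta>b (Suc t) - \<zeta>s)) \<le> 2 * (sqrt (q ^ Suc t) * sqrt K)"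
      by (fact power2_le_imp_le[OF sq(1) D] power2_le_imp_le[OF sq(2) D])+
  qed
  have span: "(\<forall>i j. ?u t $ i - ?u t $ j \<le> B t) \<and> (\<forall>i j. ?v t $ i - ?v t $ j \<le> B t)" for t
  proof (induction t)
    case 0
    have u: "\<bar>?u 0 $ i\<bar> \<le> W" for i
      using component_le_infnorm_pair(1)[of "log_ratio (\<zeta> 0) \<zeta>s" i] by (simp only: lr W_def)
    have v: "\<bar>?v 0 $ i\<bar> \<le> W" for i
      using component_le_infnorm_pair(2)[of "log_ratio (\<zeta> 0) \<zeta>s" i] by (simp only: lr W_def)
    have "0 \<le> 8 * N / \<tau> * sqrt K"
      using K tau_pos entry_norm_nonneg[of A] by simp
    \<comment> \<open>A span is at most twice the maximum norm; this is the factor 2 in front of the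
      initial log-ratio.\<close>
    then have B0: "2 * W \<le> B 0"
      by (simp add: B_def)
    have "?u 0 $ i - ?u 0 $ j \<le> B 0" for i j
      using u[of i] u[of j] B0 by linarith
    moreover have "?v 0 $ i - ?v 0 $ j \<le> B 0" for i j
      using v[of i] v[of j] B0 by linarith
    ultimately show ?case by blast
  next
    case (Suc t)
    let ?g = "gradient A (\<zeta>b (Suc t) - \<zeta>s)"
    obtain c d where L: "log_pair (\<zeta> (Suc t)) = (1 - \<eta> * \<tau>) *\<^sub>R log_pair (\<zeta> t)
        + (\<eta> * \<tau>) *\<^sub>R log_pair \<zeta>s + \<eta> *\<^sub>R ?g + (vec c, vec d)"
      using log_pair_step[where \<zeta> = "\<zeta> t" and \<eta> = \<eta> and \<xi> = "\<zeta>b (Suc t)", OF pos(1)]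
      unfolding step[symmetric] .
    have u: "?u (Suc t) = q *\<^sub>R ?u t + \<eta> *\<^sub>R fst ?g + vec c"
      using arg_cong[OF L, of fst] by (simp add: log_pair_def q_def algebra_simps)
    have v: "?v (Suc t) = q *\<^sub>R ?v t + \<eta> *\<^sub>R snd ?g + vec d"
      using arg_cong[OF L, of snd] by (simp add: log_pair_def q_def algebra_simps)
    let ?G = "N * (2 * (sqrt (q ^ Suc t) * sqrt K))"
    have gu: "\<bar>fst ?g $ i\<bar> \<le> ?G" for i
    proof -
      have "\<bar>fst ?g $ i\<bar> \<le> N * l1_norm (snd (\<zeta>b (Suc t) - \<zeta>s))"
        using matrix_vector_nth_bound[of A "snd (\<zeta>b (Suc t) - \<zeta>s)" i] by (simp only: gradient_def fst_conv)
      also have "\<dots> \<le> ?G"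
        by (intro mult_left_mono l1 entry_norm_nonneg)
      finally show ?thesis .
    qed
    have gv: "\<bar>snd ?g $ i\<bar> \<le> ?G" for i
    proof -
      have "\<bar>snd ?g $ i\<bar> \<le> N * l1_norm (fst (\<zeta>b (Suc t) - \<zeta>s))"
        using matrix_vector_nth_bound[of "transpose A" "fst (\<zeta>b (Suc t) - \<zeta>s)" i]
        by (simp only: gradient_def snd_conv entry_norm_transpose vector_uminus_component abs_minus_cancel)
      also have "\<dots> \<le> ?G"
        by (intro mult_left_mono l1 entry_norm_nonneg)
      finally show ?thesis .
    qed
    have "?u (Suc t) $ i - ?u (Suc t) $ j \<le> B (Suc t)" for i j
      using span_affine_step[OF u q less_imp_le[OF \<eta>(1)] gu, of "B t" i j] Suc.IH Bstep[of t]
      by (meson order_trans)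
    moreover have "?v (Suc t) $ i - ?v (Suc t) $ j \<le> B (Suc t)" for i j
      using span_affine_step[OF v q less_imp_le[OF \<eta>(1)] gv, of "B t" i j] Suc.IH Bstep[of t]
      by (meson order_trans)
    ultimately show ?case by blast
  qed
  have "infnorm (log_ratio (\<zeta> t) \<zeta>s) \<le> B t"
  proof (rule infnorm_pair_le)
    show "\<bar>fst (log_ratio (\<zeta> t) \<zeta>s) $ a\<bar> \<le> B t" for a
      using abs_log_ratio_le_span[OF pos'(1) qre_fst_pos] span[of t] by (simp add: log_ratio_def)
    show "\<bar>snd (log_ratio (\<zeta> t) \<zeta>s) $ a\<bar> \<le> B t" for a
      using abs_log_ratio_le_span[OF pos'(2) qre_snd_pos] span[of t] by (simp add: log_ratio_def)
  qed
  then show ?thesis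
    by (simp only: B_def W_def q_def)
qed

section \<open>Convergence rates from a potential function\<close>

lemma lyapunov_convergence:
  assumes L: "lyapunov \<eta> \<zeta> \<zeta>b L" and \<eta>: "0 < \<eta>" "\<eta> * \<tau> \<le> 1" "2 * (\<eta> * N) \<le> 1"
    and pos: "\<And>t. \<zeta> t \<in> pos_simplex \<times> pos_simplex" "\<And>t. \<zeta>b (Suc t) \<in> pos_simplex \<times> pos_simplex"
    and step: "\<And>t. \<zeta> (Suc t) = both_step A \<tau> \<eta> (\<zeta> t) (\<zeta>b (Suc t))"
  shows "max (KL \<zeta>s (\<zeta> t)) (1 / 2 * KL \<zeta>s (\<zeta>b (t + 1))) \<le> (1 - \<eta> * \<tau>) ^ t * KL \<zeta>s (\<zeta> 0)"
    and "infnorm (log_ratio (\<zeta> t) \<zeta>s) \<le> 2 * (1 - \<eta> * \<tau>) ^ t * infnorm (log_ratio (\<zeta> 0) \<zeta>s)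
      + 8 * N / \<tau> * sqrt ((1 - \<eta> * \<tau>) ^ t) * sqrt (KL \<zeta>s (\<zeta> 0))"
    and "t \<ge> 1 \<Longrightarrow> opt_gap A \<tau> \<zeta>s (\<zeta>b t) \<le> 3 * (1 / \<eta>) * (1 - \<eta> * \<tau>) ^ t * KL \<zeta>s (\<zeta> 0)"
    and "t \<ge> 1 \<Longrightarrow> dual_gap A \<tau> (\<zeta>b t)
      \<le> (1 / \<eta> + 2 * (1 / \<tau>) * N\<^sup>2) * (1 - \<eta> * \<tau>) ^ (t - 1) * KL \<zeta>s (\<zeta> 0)"
proof -
  note rates = lyapunov_rates[OF L \<eta>(1,2) pos]
  let ?K = "KL \<zeta>s (\<zeta> 0)"
  have K: "0 \<le> ?K" by (rule KL_nonneg[OF qre_pos pos(1)])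
  have q: "0 \<le> 1 - \<eta> * \<tau>" "1 - \<eta> * \<tau> \<le> 1"
    using \<eta> tau_pos by simp_all
  have decay: "(1 - \<eta> * \<tau>) ^ Suc s * ?K \<le> (1 - \<eta> * \<tau>) ^ s * ?K" for s
    using q K by (intro mult_right_mono power_decreasing) auto
  show "max (KL \<zeta>s (\<zeta> t)) (1 / 2 * KL \<zeta>s (\<zeta>b (t + 1))) \<le> (1 - \<eta> * \<tau>) ^ t * ?K"
    using rates(1)[of t] rates(2)[of t] decay[of t] by simp
  show "infnorm (log_ratio (\<zeta> t) \<zeta>s) \<le> 2 * (1 - \<eta> * \<tau>) ^ t * infnorm (log_ratio (\<zeta> 0) \<zeta>s)
      + 8 * N / \<tau> * sqrt ((1 - \<eta> * \<tau>) ^ t) * sqrt ?K"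
    by (rule log_ratio_bound[where ?\<zeta>b = \<zeta>b, OF \<eta>(1,2) K pos step rates(2)])
  have rev: "\<tau> * KL (\<zeta>b (Suc s)) \<zeta>s \<le> 1 / \<eta> * ((1 - \<eta> * \<tau>) ^ Suc s * ?K)" for s
    using rates(3)[of s] \<eta>(1) by (simp add: field_simps)
  have N: "0 \<le> N" by (rule entry_norm_nonneg)
  {
    assume "t \<ge> 1"
    then obtain s where t: "t = Suc s" by (cases t) auto
    define P where "P = (1 - \<eta> * \<tau>) ^ Suc s * ?K"
    have P: "0 \<le> P" using q K by (simp add: P_def)
    have "N * KL \<zeta>s (\<zeta>b t) \<le> N * (2 * P)"
      using rates(2)[of s] N unfolding P_def t by (rule mult_left_mono)
    \<comment> \<open>The step size gives 2 N \<le> 1 / \<eta>, so the bilinear and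
      reverse-divergence parts are each at most P / \<eta>; their sum lies within the constant
      3.\<close>
    moreover have "2 * N * P \<le> 1 / \<eta> * P"
      using \<eta> P by (intro mult_right_mono) (simp_all add: field_simps)
    moreover have "0 \<le> 1 / \<eta> * P" using P \<eta>(1) by simp
    ultimately have "opt_gap A \<tau> \<zeta>s (\<zeta>b t) \<le> 3 * (1 / \<eta> * P)"
      using opt_gap_le[OF pos(2)[of s]] rev[of s] unfolding t P_def by linarith
    then show "opt_gap A \<tau> \<zeta>s (\<zeta>b t) \<le> 3 * (1 / \<eta>) * (1 - \<eta> * \<tau>) ^ t * ?K"
      by (simp only: P_def t mult.assoc)
    have "N\<^sup>2 / \<tau> * KL \<zeta>s (\<zeta>b t) \<le> N\<^sup>2 / \<tau> * (2 * P)"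
      using rates(2)[of s] tau_pos unfolding P_def t by (intro mult_left_mono) auto
    then have "dual_gap A \<tau> (\<zeta>b t) \<le> N\<^sup>2 / \<tau> * (2 * P) + 1 / \<eta> * P"
      using dual_gap_le[OF pos(2)[of s]] rev[of s] unfolding t P_def by linarith
    also have "\<dots> = (1 / \<eta> + 2 * (1 / \<tau>) * N\<^sup>2) * P"
      by (simp add: algebra_simps)
    \<comment> \<open>The bound holds with exponent \<open>Suc s\<close>; one factor is given up to
      reach t - 1.\<close>
    also have "\<dots> \<le> (1 / \<eta> + 2 * (1 / \<tau>) * N\<^sup>2) * ((1 - \<eta> * \<tau>) ^ s * ?K)"
      using decay[of s] \<eta>(1) tau_pos unfolding P_def by (intro mult_left_mono) auto
    finally show "dual_gap A \<tau> (\<zeta>b t)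
        \<le> (1 / \<eta> + 2 * (1 / \<tau>) * N\<^sup>2) * (1 - \<eta> * \<tau>) ^ (t - 1) * ?K"
      by (simp add: t mult.assoc)
  }
qed

end

section \<open>Application to the two methods\<close>

lemma iterates_pos:
  assumes "\<zeta> 0 \<in> pos_simplex \<times> pos_simplex"
    and "\<And>t. \<zeta> (Suc t) = both_step A \<tau> h (\<zeta> t) (\<xi> t)"
  shows "\<zeta> t \<in> pos_simplex \<times> pos_simplex"
  by (induction t) (simp_all only: assms both_step_pos)

text \<open>The bound 1 / (4 N) is guarded by N \<noteq> 0 because HOL sets 1 / 0 = 0. The gap
  bounds start at t = 1 since they rest on a completed update, and PU leaves
  \<open>\<zeta>b 0\<close> free.\<close>

theorem theorem1:
  fixes A :: "real ^ 'n ^ 'm" and \<tau> \<eta> :: real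
    and \<zeta>s :: "('m::finite, 'n::finite) policies" and \<zeta> \<zeta>b :: "nat \<Rightarrow> ('m::finite, 'n::finite) policies"
  assumes "\<tau> > 0"
    and "is_qre A \<tau> \<zeta>s"
    and "fst (\<zeta> 0) \<in> prob_simplex" and "snd (\<zeta> 0) \<in> prob_simplex"
    and "\<forall>a. fst (\<zeta> 0) $ a > 0" and "\<forall>b. snd (\<zeta> 0) $ b > 0"
    and "(is_PU A \<tau> (\<lambda>_. \<eta>) \<zeta> \<zeta>b \<and> 0 < \<eta> \<and> \<eta> \<le> 1 / (\<tau> + 2 * entry_norm A)) \<or>
         (is_OMWU A \<tau> (\<lambda>_. \<eta>) \<zeta> \<zeta>b \<and> 0 < \<eta> \<and> \<eta> \<le> 1 / (2 * \<tau> + 2 * entry_norm A) \<and>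
            (entry_norm A \<noteq> 0 \<longrightarrow> \<eta> \<le> 1 / (4 * entry_norm A)))"
  shows "(\<forall>t. max (KL \<zeta>s (\<zeta> t)) (1 / 2 * KL \<zeta>s (\<zeta>b (t + 1)))
                \<le> (1 - \<eta> * \<tau>) ^ t * KL \<zeta>s (\<zeta> 0)) \<and>
         (\<forall>t. infnorm (log_ratio (\<zeta> t) \<zeta>s)
                \<le> 2 * (1 - \<eta> * \<tau>) ^ t * infnorm (log_ratio (\<zeta> 0) \<zeta>s)
                  + 8 * entry_norm A / \<tau> * sqrt ((1 - \<eta> * \<tau>) ^ t) * sqrt (KL \<zeta>s (\<zeta> 0))) \<and>
         (\<forall>t\<ge>1. opt_gap A \<tau> \<zeta>s (\<zeta>b t) \<le> 3 * (1 / \<eta>) * (1 - \<eta> * \<tau>) ^ t * KL \<zeta>s (\<zeta> 0)) \<and>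
         (\<forall>t\<ge>1. dual_gap A \<tau> (\<zeta>b t)
                \<le> (1 / \<eta> + 2 * (1 / \<tau>) * (entry_norm A)\<^sup>2) * (1 - \<eta> * \<tau>) ^ (t - 1) * KL \<zeta>s (\<zeta> 0))"
proof -
  interpret regularized_game A \<tau> \<zeta>s
    by unfold_locales (fact assms)+
  have N: "0 \<le> N" by (rule entry_norm_nonneg)
  have pos0: "\<zeta> 0 \<in> pos_simplex \<times> pos_simplex"
    using assms(3-6) by (auto simp: pos_simplex_def mem_Times_iff)
  have "\<exists>L. lyapunov \<eta> \<zeta> \<zeta>b L \<and> 0 < \<eta> \<and> \<eta> * \<tau> \<le> 1 \<and> 2 * (\<eta> * N) \<le> 1 \<and>
    (\<forall>t. \<zeta> t \<in> pos_simplex \<times> pos_simplex) \<and> (\<forall>t. \<zeta>b (Suc t) \<in> pos_simplex \<times> pos_simplex) \<and>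
    (\<forall>t. \<zeta> (Suc t) = both_step A \<tau> \<eta> (\<zeta> t) (\<zeta>b (Suc t)))"
    using assms(7)
  proof (elim disjE conjE)
    assume PU: "is_PU A \<tau> (\<lambda>_. \<eta>) \<zeta> \<zeta>b" and \<eta>: "0 < \<eta>" "\<eta> \<le> 1 / (\<tau> + 2 * N)"
    have step: "\<zeta> (Suc t) = both_step A \<tau> \<eta> (\<zeta> t) (\<zeta>b (Suc t))"
      and mid: "\<zeta>b (Suc t) = both_step A \<tau> \<eta> (\<zeta> t) (\<zeta> t)" for t
      using PU by (simp_all add: is_PU_def)
    note pos = iterates_pos[where \<zeta> = \<zeta>, OF pos0 step]
    have mpos: "\<zeta>b (Suc t) \<in> pos_simplex \<times> pos_simplex" for t
      unfolding mid by (rule both_step_pos[OF pos])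
    have e: "\<eta> * \<tau> + 2 * (\<eta> * N) \<le> 1"
      using \<eta>(2) tau_pos N by (simp add: pos_le_divide_eq add_pos_nonneg algebra_simps)
    moreover have "0 \<le> \<eta> * N" "0 \<le> \<eta> * \<tau>"
      using \<eta>(1) N tau_pos by simp_all
    ultimately have "\<eta> * \<tau> \<le> 1" "2 * (\<eta> * N) \<le> 1"
      by linarith+
    then show ?thesis
      using lyapunov_PU[OF PU pos \<eta>(1) e] \<eta>(1) pos mpos step by blast
  next
    assume OMWU: "is_OMWU A \<tau> (\<lambda>_. \<eta>) \<zeta> \<zeta>b" and \<eta>: "0 < \<eta>" "\<eta> \<le> 1 / (2 * \<tau> + 2 * N)"
      and \<eta>': "N \<noteq> 0 \<longrightarrow> \<eta> \<le> 1 / (4 * N)"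
    have step: "\<zeta> (Suc t) = both_step A \<tau> \<eta> (\<zeta> t) (\<zeta>b (Suc t))"
      and mid: "\<zeta>b (Suc t) = both_step A \<tau> \<eta> (\<zeta> t) (\<zeta>b t)" and "\<zeta>b 0 = \<zeta> 0" for t
      using OMWU by (simp_all add: is_OMWU_def)
    note pos = iterates_pos[where \<zeta> = \<zeta>, OF pos0 step]
    \<comment> \<open>Time 0 is included because the OMWU potential contains
      \<open>KL (\<zeta> 0) (\<zeta>b 0)\<close>.\<close>
    have mpos: "\<zeta>b t \<in> pos_simplex \<times> pos_simplex" for t
    proof (cases t)
      case 0
      then show ?thesis using pos[of 0] \<open>\<zeta>b 0 = \<zeta> 0\<close> by simp
    next
      case (Suc s)
      then show ?thesis using both_step_pos[OF pos] by (simp only: mid)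
    qed
    have e: "\<eta> * \<tau> + \<eta> * N \<le> 1 / 2"
      using \<eta>(2) tau_pos N by (simp add: pos_le_divide_eq add_pos_nonneg algebra_simps)
    have e': "\<eta> * N \<le> 1 / 4"
      using \<eta>' N by (cases "N = 0") (simp_all add: field_simps)
    have "0 \<le> \<eta> * N" "0 \<le> \<eta> * \<tau>"
      using \<eta>(1) N tau_pos by simp_all
    then have "\<eta> * \<tau> \<le> 1" "2 * (\<eta> * N) \<le> 1"
      using e e' by linarith+
    then show ?thesis
      using lyapunov_OMWU[OF OMWU pos mpos \<eta>(1) e e'] \<eta>(1) pos mpos step by blast
  qed
  then obtain L where L: "lyapunov \<eta> \<zeta> \<zeta>b L" "0 < \<eta>" "\<eta> * \<tau> \<le> 1" "2 * (\<eta> * N) \<le> 1"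
    "\<And>t. \<zeta> t \<in> pos_simplex \<times> pos_simplex" "\<And>t. \<zeta>b (Suc t) \<in> pos_simplex \<times> pos_simplex"
    "\<And>t. \<zeta> (Suc t) = both_step A \<tau> \<eta> (\<zeta> t) (\<zeta>b (Suc t))"
    by blast
  show ?thesis
    using lyapunov_convergence[OF L] by blast
qed

end
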